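(* Let $\lambda\in\mathbb{R}_+$, and consider the integer program $$(P)\qquad \min\{f(x)\ |\ g(x)\leq 0,\ \|x\|_1\leq\lambda,\ x\in\mathbb{Z}^n\}.$$ If $f,g$ are computable in polynomial time, then Algorithm 1 (described in the context) solves $(P)$ in polynomial time for fixed $\lambda$. When $s$ is the most bits needed to represent the objective or a constraint, and $\delta\in(0,1)$, some specific cases are: 1. Integer Linear Program (ILP): If $f=c'x$ and $g=Ax-b$, where $A\in\mathbb{Q}^{m\times n}$, $b\in\mathbb{Q}^m$, and $c\in\mathbb{Q}^n$, then Algorithm 1 solves $(P)$ in $O\big(s^2mn^{((2+\delta)\lfloor\lambda\rfloor)^2/2+1}\big)$ time. 2. (Non-convex) Integer Quadratic Program (IQP): If $f=x'Q'x+c'x$ and $g_i=x'A_ix+b_i'x+c_i$ for $i\in[m]$, where $A_i,Q\in\mathbb{Q}^{n\times n}$, $b_i,c\in\mathbb{Q}^n$, and $c_i\in\mathbb{Q}$, then Algorithm 1 solves $(P)$ in $O\big(s^2mn^{((2+\delta)\lfloor\lambda\rfloor)^2/2+2}\big)$ time. 3. (Non-convex) Integer Quadratically-Constrained Quadratic Program (IQCQP): If $f=x'Qx+c'x$ and $g_i=x'A_ix+b_i'x+c_i$ for $i\in[m]$, where $A_i,Q\in\mathbb{Q}^{n\times n}$, $b_i,c\in\mathbb{Q}^n$, and $c_i\in\mathbb{Q}$, then Algorithm 1 solves $(P)$ in $O\big(s^2mn^{((2+\delta)\lfloor\lambda\rfloor)^2/2+2}\big)$ time.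
   Context: Notation: $\mathbb{N}=\{0,1,2,\ldots\}$, $[r]=\{1,\ldots,r\}$, $\|x\|_1=\sum_j|x_j|$, $\lfloor r\rfloor$ is the floor of $r$, a prime denotes transpose, $\circ$ is the elementwise (Hadamard) product, and $\mathbf{1}(A)$ is $1$ if $A$ is true and $0$ otherwise. The constraint $g(x)\leq 0$ is componentwise, with $m$ the number of constraints. The radius $\lambda$ is treated as a fixed parameter; "polynomial" means polynomial simultaneously in the dimension $n$, the number of constraints and the bit size. "Time" means arithmetic (bit) time, in which the dot product of two vectors in $\mathbb{Q}^n$ is counted as $O(s^2n)$ and a quadratic form of an $n\times n$ rational matrix as $O(s^2n^2)$. $M_k^N$ denotes the set of vectors $u\in[N]^k$ with $u_i\leq u_{i+1}$ for all $i\in[k-1]$ (i.e. the $k$-multisets of $[N]$, written in nondecreasing order). The map $\varphi:M_k^N\to\mathbb{N}^k$ is given by $(\varphi(u))_1=u_1-1$ and $(\varphi(u))_i=u_i-u_{i-1}$ for $i\in\{2,\ldots,k\}$. For a binary vector $b\in\{0,1\}^n$, $\mathrm{SignPerm}(b)$ is the set of all sign ($+/-$) permutations of the nonzero entries of $b$, i.e. all vectors $\sigma$ with $\sigma_i\in\{-1,+1\}$ if $b_i=1$ and $\sigma_i=0$ if $b_i=0$. Algorithm 1: Set $f^*:=+\infty$. For all $u\in M_n^{\lfloor\lambda\rfloor+1}$: set $v:=\varphi(u)$; for all $i\in[n]$ set $b_i:=\mathbf{1}(v_i\neq 0)$; for all $\sigma\in\mathrm{SignPerm}(b)$: set $x:=v\circ\sigma$,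 and if $f(x)<f^*$ and $g(x)\leq 0$, set $x^*:=x$ and $f^*:=f(x)$. Cost conventions for generation (by standard combinatorial generation algorithms): each element of $M_k^N$ can be generated in $O(\log N)$ arithmetic time, and each element of $\mathrm{SignPerm}(b)$, $b\in\{0,1\}^k$, in $O(\log k)$ arithmetic time. *)

theory Defs
  imports
    Complex_Main
    "HOL-Library.Log_Nat"
    "HOL-Computational_Algebra.Polynomial"
    "Jordan_Normal_Form.Matrix"
begin

section \<open>Bit sizes\<close>

text \<open>One sign bit plus the binary digits of the absolute value.\<close>

definition int_bits :: "int \<Rightarrow> nat" where
  "int_bits z = 1 + floorlog 2 (nat \<bar>z\<bar>)"

definition rat_bits :: "rat \<Rightarrow> nat" where
  "rat_bits r = (case quotient_of r of (p, q) \<Rightarrow> int_bits p + int_bits q)"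

definition vec_bits :: "rat vec \<Rightarrow> nat" where
  "vec_bits v = (\<Sum>i<dim_vec v. rat_bits (v $ i))"

definition mat_bits :: "rat mat \<Rightarrow> nat" where
  "mat_bits A = (\<Sum>i<dim_row A. \<Sum>j<dim_col A. rat_bits (A $$ (i, j)))"

abbreviation rat_vec :: "int vec \<Rightarrow> rat vec" where
  "rat_vec x \<equiv> map_vec of_int x"


section \<open>Integer programs with a bound on the 1-norm\<close>

record int_prog =
  ip_dim :: nat
  ip_ncon :: nat
  ip_obj :: "int vec \<Rightarrow> rat"
  ip_con :: "int vec \<Rightarrow> rat vec"

definition l1_norm :: "int vec \<Rightarrow> int" where
  "l1_norm x = (\<Sum>i<dim_vec x. \<bar>x $ i\<bar>)"

definition feasible :: "int_prog \<Rightarrow> real \<Rightarrow> int vec set" where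
  "feasible P l = {x \<in> carrier_vec (ip_dim P).
     ip_con P x \<le> 0\<^sub>v (ip_ncon P) \<and> of_int (l1_norm x) \<le> l}"

text \<open>
  The content of the two variables \<open>x\<^sup>*\<close> and \<open>f\<^sup>*\<close>: \<^term>\<open>None\<close> means that \<open>x\<^sup>*\<close> has not
  been assigned, respectively that \<open>f\<^sup>* = +\<infinity>\<close>.
\<close>

type_synonym incumbent = "int vec option \<times> rat option"

definition solves :: "int_prog \<Rightarrow> real \<Rightarrow> incumbent \<Rightarrow> bool" where
  "solves P l r \<longleftrightarrow>
     (if feasible P l = {} then r = (None, None)
      else \<exists>x. is_arg_min (ip_obj P) (\<lambda>y. y \<in> feasible P l) x \<and> r = (Some x, Some (ip_obj P x)))"


section \<open>Multisets, the map \<open>\<phi>\<close>, and sign permutations\<close>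

text \<open>Vectors are indexed from 0, so the component \<open>u\<^sub>1\<close> is \<open>u $ 0\<close>.\<close>

definition msets :: "nat \<Rightarrow> nat \<Rightarrow> nat vec set" where
  "msets k N = {u \<in> carrier_vec k.
     (\<forall>i<k. u $ i \<in> {1..N}) \<and> (\<forall>i. Suc i < k \<longrightarrow> u $ i \<le> u $ Suc i)}"

text \<open>On \<^const>\<open>msets\<close> the subtractions below never truncate.\<close>

definition phi :: "nat vec \<Rightarrow> nat vec" where
  "phi u = vec (dim_vec u) (\<lambda>i. if i = 0 then u $ 0 - 1 else u $ i - u $ (i - 1))"

definition binary_vec :: "nat vec \<Rightarrow> bool" where
  "binary_vec b \<longleftrightarrow> (\<forall>i<dim_vec b. b $ i \<in> {0, 1})"

definition sign_perm :: "nat vec \<Rightarrow> int vec set" where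
  "sign_perm b = {\<sigma> \<in> carrier_vec (dim_vec b).
     \<forall>i<dim_vec b. (b $ i = 1 \<longrightarrow> \<sigma> $ i \<in> {-1, 1}) \<and> (b $ i = 0 \<longrightarrow> \<sigma> $ i = 0)}"

definition support_vec :: "nat vec \<Rightarrow> nat vec" where
  "support_vec v = vec (dim_vec v) (\<lambda>i. if v $ i \<noteq> 0 then 1 else 0)"

definition hadamard :: "nat vec \<Rightarrow> int vec \<Rightarrow> int vec" where
  "hadamard v \<sigma> = vec (dim_vec v) (\<lambda>i. int (v $ i) * \<sigma> $ i)"


section \<open>Arithmetic time\<close>

text \<open>
  An execution model fixes the order in which the two combinatorial generators list their
  elements, and the bit cost of every primitive step. The costs are arbitrary numbers subject
  to the upper bounds in \<open>cost_conventions\<close>, which are the O-conventions for generation, dot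
  products and quadratic forms together with quadratic (schoolbook) cost for a single arithmetic
  operation, comparison or assignment on the listed rational operands.
\<close>

datatype elem_op = Add | Sub | Mul | Cmp | Assign

record exec_model =
  mset_order :: "nat \<Rightarrow> nat \<Rightarrow> nat vec list"
  sign_order :: "nat vec \<Rightarrow> int vec list"
  mset_cost :: "nat \<Rightarrow> nat \<Rightarrow> nat vec \<Rightarrow> nat"
  sign_cost :: "nat vec \<Rightarrow> int vec \<Rightarrow> nat"
  op_cost :: "elem_op \<Rightarrow> rat list \<Rightarrow> nat"
  dot_cost :: "rat vec \<Rightarrow> rat vec \<Rightarrow> nat"
  quad_cost :: "rat mat \<Rightarrow> rat vec \<Rightarrow> nat"

definition valid_orders :: "exec_model \<Rightarrow> bool" where
  "valid_orders E \<longleftrightarrow>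
     (\<forall>k N. distinct (mset_order E k N) \<and> set (mset_order E k N) = msets k N) \<and>
     (\<forall>b. binary_vec b \<longrightarrow> distinct (sign_order E b) \<and> set (sign_order E b) = sign_perm b)"

text \<open>
  The summand 1 next to the logarithms only avoids that the bound vanishes for argument 1.
\<close>

definition cost_conventions :: "exec_model \<Rightarrow> bool" where
  "cost_conventions E \<longleftrightarrow> (\<exists>K::real.
     (\<forall>k N. \<forall>u\<in>msets k N. mset_cost E k N u \<le> K * (1 + log 2 N)) \<and>
     (\<forall>b. binary_vec b \<longrightarrow> (\<forall>\<sigma>\<in>sign_perm b. sign_cost E b \<sigma> \<le> K * (1 + log 2 (dim_vec b)))) \<and>
     (\<forall>oper rs. op_cost E oper rs \<le> K * (1 + real (\<Sum>r\<leftarrow>rs. rat_bits r))\<^sup>2) \<and>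
     (\<forall>n s. \<forall>a\<in>carrier_vec n. \<forall>x\<in>carrier_vec n. vec_bits a \<le> s \<longrightarrow> vec_bits x \<le> s \<longrightarrow>
        dot_cost E a x \<le> K * (real s)\<^sup>2 * real n) \<and>
     (\<forall>n s. \<forall>Q\<in>carrier_mat n n. \<forall>x\<in>carrier_vec n. mat_bits Q \<le> s \<longrightarrow> vec_bits x \<le> s \<longrightarrow>
        quad_cost E Q x \<le> K * (real s)\<^sup>2 * (real n)\<^sup>2))"


section \<open>The algorithm\<close>

text \<open>
  The state of the algorithm is the incumbent together with the time spent so far.
  The parameters \<open>cf\<close> and \<open>cg\<close> are the costs of evaluating the objective and the vector of
  constraint functions at a point.
\<close>

definition visit ::
  "exec_model \<Rightarrow> int_prog \<Rightarrow> (int vec \<Rightarrow> nat) \<Rightarrow> (int vec \<Rightarrow> nat) \<Rightarrow> nat vec \<Rightarrow> nat vec \<Rightarrow> int vec \<Rightarrow>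
   incumbent \<times> nat \<Rightarrow> incumbent \<times> nat" where
  "visit E P cf cg v b \<sigma> s =
    (let ((xs, fs), t) = s;
         x = hadamard v \<sigma>;
         y = ip_obj P x;
         z = ip_con P x;
         better = (case fs of None \<Rightarrow> True | Some f \<Rightarrow> y < f);
         update = (better \<and> z \<le> 0\<^sub>v (ip_ncon P));
         time = sign_cost E b \<sigma>
           + (\<Sum>i<dim_vec v. op_cost E Mul [of_nat (v $ i), of_int (\<sigma> $ i)])
           + cf x + cg x
           + op_cost E Cmp (case fs of None \<Rightarrow> [y] | Some f \<Rightarrow> [y, f])
           + (\<Sum>i<dim_vec z. op_cost E Cmp [z $ i, 0])
           + (if update
              then (\<Sum>i<dim_vec x. op_cost E Assign [of_int (x $ i)]) + op_cost E Assign [y]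
              else 0)
     in (if update then (Some x, Some y) else (xs, fs), t + time))"

definition process_mset ::
  "exec_model \<Rightarrow> int_prog \<Rightarrow> (int vec \<Rightarrow> nat) \<Rightarrow> (int vec \<Rightarrow> nat) \<Rightarrow> nat \<Rightarrow> nat vec \<Rightarrow>
   incumbent \<times> nat \<Rightarrow> incumbent \<times> nat" where
  "process_mset E P cf cg N u s =
    (let (r, t) = s;
         v = phi u;
         b = support_vec v;
         time = mset_cost E (ip_dim P) N u
           + (\<Sum>i<dim_vec u. op_cost E Sub
                [of_nat (u $ i), if i = 0 then 1 else of_nat (u $ (i - 1))])
           + (\<Sum>i<dim_vec v. op_cost E Cmp [of_nat (v $ i), 0])
           + (\<Sum>i<dim_vec b. op_cost E Assign [of_nat (b $ i)])
     in fold (visit E P cf cg v b) (sign_order E b) (r, t + time))"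

definition algorithm1 ::
  "exec_model \<Rightarrow> int_prog \<Rightarrow> (int vec \<Rightarrow> nat) \<Rightarrow> (int vec \<Rightarrow> nat) \<Rightarrow> real \<Rightarrow> incumbent \<times> nat" where
  "algorithm1 E P cf cg l =
    (let N = nat \<lfloor>l\<rfloor> + 1
     in fold (process_mset E P cf cg N) (mset_order E (ip_dim P) N)
          ((None, None), op_cost E Assign []))"


section \<open>Turing machines and polynomial-time computability\<close>

text \<open>
  Deterministic machines with one two-way infinite tape over the symbols \<open>0, 1, \<dots>\<close>, where 0 is
  the blank and 1, 2, 3 stand for the bits 0 and 1 and a separator. State 0 is initial and state 1
  is halting; the last component of a transition is the head movement.
\<close>

record tm =
  tm_states :: nat
  tm_symbols :: nat
  tm_trans :: "nat \<Rightarrow> nat \<Rightarrow> nat \<times> nat \<times> int"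

definition wf_tm :: "tm \<Rightarrow> bool" where
  "wf_tm M \<longleftrightarrow> 2 \<le> tm_states M \<and> 4 \<le> tm_symbols M \<and>
     (\<forall>q<tm_states M. \<forall>a<tm_symbols M. case tm_trans M q a of (q', a', d) \<Rightarrow>
        q' < tm_states M \<and> a' < tm_symbols M \<and> d \<in> {-1, 0, 1})"

type_synonym tm_config = "nat \<times> (int \<Rightarrow> nat) \<times> int"

definition tm_init :: "nat list \<Rightarrow> tm_config" where
  "tm_init w = (0, (\<lambda>i. if 0 \<le> i \<and> i < int (length w) then w ! nat i else 0), 0)"

definition tm_step :: "tm \<Rightarrow> tm_config \<Rightarrow> tm_config" where
  "tm_step M c = (case c of (q, tape, h) \<Rightarrow>
     if q = 1 then c
     else (case tm_trans M q (tape h) of (q', a, d) \<Rightarrow> (q', tape(h := a), h + d)))"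

definition tm_run :: "tm \<Rightarrow> nat list \<Rightarrow> nat \<Rightarrow> tm_config" where
  "tm_run M w t = (tm_step M ^^ t) (tm_init w)"

text \<open>After \<open>t\<close> steps the machine has halted; the output extends from cell 0 to the first blank.\<close>

definition tm_computes :: "tm \<Rightarrow> nat list \<Rightarrow> nat list \<Rightarrow> nat \<Rightarrow> bool" where
  "tm_computes M w out t \<longleftrightarrow> (case tm_run M w t of (q, tape, h) \<Rightarrow>
     q = 1 \<and> (\<forall>i<length out. tape (int i) = out ! i) \<and> tape (int (length out)) = 0)"

definition tm_time :: "tm \<Rightarrow> nat list \<Rightarrow> nat" where
  "tm_time M w = (LEAST t. fst (tm_run M w t) = 1)"

definition bits_word :: "bool list \<Rightarrow> nat list" where
  "bits_word bs = map (\<lambda>b. if b then 2 else 1) bs"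

text \<open>Sign bit, then the binary digits (least significant first), then a separator.\<close>

definition int_word :: "int \<Rightarrow> nat list" where
  "int_word z =
     bits_word ((z < 0) # map (bit (nat \<bar>z\<bar>)) [0..<floorlog 2 (nat \<bar>z\<bar>)]) @ [3]"

definition rat_word :: "rat \<Rightarrow> nat list" where
  "rat_word r = (case quotient_of r of (p, q) \<Rightarrow> int_word p @ int_word q)"

definition vec_word :: "('a \<Rightarrow> nat list) \<Rightarrow> 'a vec \<Rightarrow> nat list" where
  "vec_word code v = concat (map code (list_of_vec v))"

definition eval_input :: "bool list \<Rightarrow> int vec \<Rightarrow> nat list" where
  "eval_input w x = bits_word w @ [3] @ vec_word int_word x"

text \<open>
  A class of integer programs is a set \<open>I\<close> of instances, each given by its binary description
  \<open>w\<close>, with \<open>P w\<close> the program described by \<open>w\<close>. The machine \<open>M\<close> evaluates the function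
  \<open>h w\<close> (the objective or the constraint vector of \<open>P w\<close>) at integer points in time
  polynomial in the dimension, the number of constraints, and the bit size of its input.
\<close>

definition evaluates_in_poly_time ::
  "tm \<Rightarrow> bool list set \<Rightarrow> (bool list \<Rightarrow> int_prog) \<Rightarrow> (bool list \<Rightarrow> int vec \<Rightarrow> 'a) \<Rightarrow>
   ('a \<Rightarrow> nat list) \<Rightarrow> bool" where
  "evaluates_in_poly_time M I P h code \<longleftrightarrow> wf_tm M \<and>
     (\<exists>p :: nat poly. \<forall>w\<in>I. \<forall>x\<in>carrier_vec (ip_dim (P w)).
        \<exists>t \<le> poly p (ip_dim (P w) + ip_ncon (P w) + length w + vec_bits (rat_vec x)).
          tm_computes M (eval_input w x) (code (h w x)) t)"

text \<open>Cost of one evaluation: writing the input, running the machine, reading the output.\<close>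

definition tm_eval_cost ::
  "tm \<Rightarrow> ('a \<Rightarrow> nat list) \<Rightarrow> (int vec \<Rightarrow> 'a) \<Rightarrow> bool list \<Rightarrow> int vec \<Rightarrow> nat" where
  "tm_eval_cost M code h w x =
     length (eval_input w x) + tm_time M (eval_input w x) + length (code (h x))"


section \<open>Linear and quadratic programs\<close>

definition ilp :: "rat mat \<Rightarrow> rat vec \<Rightarrow> rat vec \<Rightarrow> int_prog" where
  "ilp A b c = \<lparr>ip_dim = dim_col A, ip_ncon = dim_row A,
     ip_obj = (\<lambda>x. c \<bullet> rat_vec x),
     ip_con = (\<lambda>x. A *\<^sub>v rat_vec x - b)\<rparr>"

definition ilp_bits :: "rat mat \<Rightarrow> rat vec \<Rightarrow> rat vec \<Rightarrow> nat" where
  "ilp_bits A b c =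
     Max (insert (vec_bits c) ((\<lambda>i. vec_bits (row A i) + rat_bits (b $ i)) ` {..<dim_row A}))"

definition ilp_obj_cost :: "exec_model \<Rightarrow> rat vec \<Rightarrow> int vec \<Rightarrow> nat" where
  "ilp_obj_cost E c x = dot_cost E c (rat_vec x)"

definition ilp_con_cost :: "exec_model \<Rightarrow> rat mat \<Rightarrow> rat vec \<Rightarrow> int vec \<Rightarrow> nat" where
  "ilp_con_cost E A b x = (\<Sum>i<dim_row A.
     dot_cost E (row A i) (rat_vec x) + op_cost E Sub [row A i \<bullet> rat_vec x, b $ i])"

definition quad_form :: "rat mat \<Rightarrow> rat vec \<Rightarrow> rat" where
  "quad_form Q x = x \<bullet> (Q *\<^sub>v x)"

text \<open>
  Constraint \<open>i < m\<close> is \<open>x'(A i)x + (b i)'x + d $ i \<le> 0\<close>.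
\<close>

definition iqp ::
  "nat \<Rightarrow> nat \<Rightarrow> rat mat \<Rightarrow> rat vec \<Rightarrow> (nat \<Rightarrow> rat mat) \<Rightarrow> (nat \<Rightarrow> rat vec) \<Rightarrow> rat vec \<Rightarrow> int_prog" where
  "iqp n m Q c A b d = \<lparr>ip_dim = n, ip_ncon = m,
     ip_obj = (\<lambda>x. quad_form Q (rat_vec x) + c \<bullet> rat_vec x),
     ip_con = (\<lambda>x. vec m (\<lambda>i. quad_form (A i) (rat_vec x) + b i \<bullet> rat_vec x + d $ i))\<rparr>"

definition iqp_bits ::
  "nat \<Rightarrow> rat mat \<Rightarrow> rat vec \<Rightarrow> (nat \<Rightarrow> rat mat) \<Rightarrow> (nat \<Rightarrow> rat vec) \<Rightarrow> rat vec \<Rightarrow> nat" where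
  "iqp_bits m Q c A b d =
     Max (insert (mat_bits Q + vec_bits c)
       ((\<lambda>i. mat_bits (A i) + vec_bits (b i) + rat_bits (d $ i)) ` {..<m}))"

definition iqp_obj_cost :: "exec_model \<Rightarrow> rat mat \<Rightarrow> rat vec \<Rightarrow> int vec \<Rightarrow> nat" where
  "iqp_obj_cost E Q c x = quad_cost E Q (rat_vec x) + dot_cost E c (rat_vec x)
     + op_cost E Add [quad_form Q (rat_vec x), c \<bullet> rat_vec x]"

definition iqp_con_cost ::
  "exec_model \<Rightarrow> nat \<Rightarrow> (nat \<Rightarrow> rat mat) \<Rightarrow> (nat \<Rightarrow> rat vec) \<Rightarrow> rat vec \<Rightarrow> int vec \<Rightarrow> nat" where
  "iqp_con_cost E m A b d x = (\<Sum>i<m.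
     quad_cost E (A i) (rat_vec x) + dot_cost E (b i) (rat_vec x)
     + op_cost E Add [quad_form (A i) (rat_vec x), b i \<bullet> rat_vec x]
     + op_cost E Add [quad_form (A i) (rat_vec x) + b i \<bullet> rat_vec x, d $ i])"

end

theory Submission
  imports Defs
begin

text \<open>
  Put \<open>L = \<lfloor>\<lambda>\<rfloor>\<close>. The map \<open>\<phi>\<close> is a bijection from the multisets onto the
  nonnegative integer vectors of 1-norm at most \<open>L\<close> (its inverse takes partial sums), so multisets and
  sign permutations together enumerate exactly the lattice points of the 1-norm ball
  (\<open>visited_points\<close>). The algorithm keeps the best feasible point met so far and is therefore correct.
  A multiset is determined by the \<open>L\<close> positions where it first exceeds \<open>1, \<dots>, L\<close>, and a vector of
  1-norm at most \<open>L\<close> has at most \<open>L\<close> nonzero entries; hence at most \<open>(n + 1)\<^sup>L 2\<^sup>L\<close> points are visited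
  (\<open>card_msets_le\<close>, \<open>card_sign_perm_le\<close>), a polynomial number for fixed \<open>L\<close>.

  It remains to bound the cost of a single visit. This cost contains the evaluation of objective and
  constraints, but also comparisons and arithmetic on the computed values, whose cost is quadratic in
  their bit size. The locale \<open>bounded_run\<close> takes a bound \<open>T\<close> for the former and \<open>B\<close> for the sizes and
  yields the time bound \<open>c (n + 1)\<^sup>L (T + (n + m + 1)(B + 1)\<^sup>2)\<close>, with \<open>c\<close> depending only on \<open>L\<close> and the
  cost constant (\<open>algorithm1_bounded_run\<close>). All three kinds of programs are instances.

  For linear and quadratic programs, \<open>B = O(s)\<close>: a value is a sum of products of rationals, and the
  measure \<open>\<bar>numerator\<bar> + denominator\<close> of fractions is submultiplicative under sums and products, so its
  logarithm for the value is bounded by the total over all factors (\<open>fits_scalar_prod\<close>,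
  \<open>fits_quad_form\<close>). The points themselves have \<open>O(n)\<close> bits, and \<open>s \<ge> 3n\<close> as each coefficient takes at
  least three bits. So one visit costs \<open>O(s\<^sup>2 m n)\<close>, respectively \<open>O(s\<^sup>2 m n\<^sup>2)\<close>, and the claimed exponent
  follows from \<open>L \<le> 2 L\<^sup>2 \<le> ((2 + \<delta>) L)\<^sup>2 / 2\<close>.

  For functions computed by a machine, \<open>T\<close> is polynomial by assumption. So is \<open>B\<close>, because a machine
  cannot write more symbols than the length of its input plus the number of its steps
  (\<open>tm_computes_output_length\<close>).
\<close>

section \<open>Sizes of rational numbers\<close>

text \<open>
  Numerator and denominator together, rather than bounded separately: this is the measure for which
  sizes add up under both addition and multiplication of fractions, since
  \<open>\<bar>ad + cb\<bar> + bd\<close> and \<open>\<bar>ac\<bar> + bd\<close> are at most \<open>(\<bar>a\<bar> + b)(\<bar>c\<bar> + d)\<close>. The bit length itself would lose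
  a factor 2 in each of the additions of a long sum. Fractions that are not in lowest terms are
  admitted so that sums and products can be formed without cancelling.
\<close>

definition fits :: "rat \<Rightarrow> nat \<Rightarrow> bool" where
  "fits r k \<longleftrightarrow> (\<exists>a b. 0 < b \<and> r = of_int a / of_int b \<and> \<bar>a\<bar> + b \<le> 2 ^ k)"

lemma less_two_power_floorlog: "n < 2 ^ floorlog 2 n"
proof (cases "n = 0")
  case False
  then show ?thesis using floorlog_bounds[of n 2] by auto
qed (simp add: floorlog_def)

lemma floorlog_le: "n < 2 ^ k \<Longrightarrow> floorlog 2 n \<le> k"
  by (rule floorlog_leI) auto

lemma int_bits_le: "int_bits z \<le> 1 + nat \<bar>z\<bar>"
  using floorlog_le[of "nat \<bar>z\<bar>" "nat \<bar>z\<bar>"] by (simp add: int_bits_def)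

lemma rat_bits_of_int: "rat_bits (of_int z) = int_bits z + 2"
  by (simp add: rat_bits_def int_bits_def floorlog_def)

lemma rat_bits_of_int_le: "rat_bits (of_int z) \<le> 3 + nat \<bar>z\<bar>"
  using int_bits_le[of z] by (simp add: rat_bits_of_int)

lemma rat_bits_of_nat_le: "rat_bits (of_nat k) \<le> 3 + k"
  using rat_bits_of_int_le[of "int k"] by simp

lemma rat_bits_ge_3: "3 \<le> rat_bits r"
proof -
  obtain p q where pq: "quotient_of r = (p, q)" by fastforce
  then have "0 < q" by (rule quotient_of_denom_pos)
  then have "0 < nat \<bar>q\<bar>" by simp
  then have "floorlog 2 (nat \<bar>q\<bar>) \<noteq> 0"
    using less_two_power_floorlog[of "nat \<bar>q\<bar>"] by (auto simp: floorlog_def)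
  then show ?thesis by (simp add: rat_bits_def pq int_bits_def)
qed

lemma fits_0: "fits 0 0"
  unfolding fits_def by (rule exI[of _ 0], rule exI[of _ 1]) simp

lemma fits_rat_bits: "fits r (rat_bits r)"
proof -
  obtain p q where pq: "quotient_of r = (p, q)" by fastforce
  let ?i = "floorlog 2 (nat \<bar>p\<bar>)" and ?j = "floorlog 2 (nat \<bar>q\<bar>)"
  have q: "0 < q" using pq by (rule quotient_of_denom_pos)
  have "nat \<bar>p\<bar> + nat \<bar>q\<bar> \<le> 2 ^ ?i + 2 ^ ?j"
    by (intro add_mono less_imp_le less_two_power_floorlog)
  also have "\<dots> \<le> 2 ^ (?i + ?j) + 2 ^ (?i + ?j)"
    by (intro add_mono power_increasing) auto
  also have "\<dots> \<le> 2 ^ rat_bits r"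
    unfolding mult_2[symmetric] power_Suc[symmetric]
    by (intro power_increasing) (auto simp: rat_bits_def pq int_bits_def)
  finally have "int (nat \<bar>p\<bar> + nat \<bar>q\<bar>) \<le> int (2 ^ rat_bits r)"
    unfolding of_nat_le_iff .
  then have "\<bar>p\<bar> + q \<le> 2 ^ rat_bits r" using q by simp
  then show ?thesis
    unfolding fits_def using q quotient_of_div[OF pq] by blast
qed

text \<open>
  Cancelling common factors only shrinks the numerator and the denominator, so a bound for some
  fraction bounds the reduced one, whose bits are counted by \<^const>\<open>rat_bits\<close>.
\<close>

lemma rat_bits_le_fits:
  assumes "fits r k"
  shows "rat_bits r \<le> 2 * k + 4"
proof -
  obtain a b where ab: "0 < b" "r = of_int a / of_int b" "\<bar>a\<bar> + b \<le> 2 ^ k"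
    using assms unfolding fits_def by blast
  obtain p q where pq: "quotient_of r = (p, q)" by fastforce
  have q: "0 < q" using pq by (rule quotient_of_denom_pos)
  have "rat_of_int p / rat_of_int q = rat_of_int a / rat_of_int b"
    using ab(2) quotient_of_div[OF pq] by simp
  then have "rat_of_int (p * b) = rat_of_int (a * q)"
    using q ab(1) by (simp add: field_simps)
  then have eq: "p * b = a * q" by (simp only: of_int_eq_iff)
  have "q dvd p * b" by (simp add: eq)
  then have "q dvd b"
    using quotient_of_coprime[OF pq] by (simp add: coprime_commute coprime_dvd_mult_right_iff)
  then have qb: "q \<le> b" using ab(1) by (rule zdvd_imp_le)
  have "\<bar>p\<bar> * b = \<bar>a\<bar> * q" using eq ab(1) q by (metis abs_mult abs_of_pos)
  also have "\<dots> \<le> \<bar>a\<bar> * b" using qb by (simp add: mult_left_mono)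
  finally have pa: "\<bar>p\<bar> \<le> \<bar>a\<bar>" using ab(1) by simp
  have "nat \<bar>p\<bar> < 2 ^ (k + 1)" "nat \<bar>q\<bar> < 2 ^ (k + 1)"
  proof -
    have "\<bar>p\<bar> < 2 ^ (k + 1)" "\<bar>q\<bar> < 2 ^ (k + 1)"
      using pa qb q ab(1,3) zero_less_power[of "2::int" k] by auto
    then show "nat \<bar>p\<bar> < 2 ^ (k + 1)" "nat \<bar>q\<bar> < 2 ^ (k + 1)"
      by (simp_all add: nat_less_iff)
  qed
  then have "floorlog 2 (nat \<bar>p\<bar>) \<le> k + 1" "floorlog 2 (nat \<bar>q\<bar>) \<le> k + 1"
    by (auto intro: floorlog_le)
  then show ?thesis by (simp add: rat_bits_def pq int_bits_def)
qed

lemma fits_add: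
  assumes "fits r k" "fits s l"
  shows "fits (r + s) (k + l)"
proof -
  obtain a b c d where r: "0 < b" "r = of_int a / of_int b" "\<bar>a\<bar> + b \<le> 2 ^ k"
    and s: "0 < d" "s = of_int c / of_int d" "\<bar>c\<bar> + d \<le> 2 ^ l"
    using assms unfolding fits_def by blast
  have "\<bar>a * d + c * b\<bar> + b * d \<le> \<bar>a\<bar> * d + \<bar>c\<bar> * b + b * d"
    using abs_triangle_ineq[of "a * d" "c * b"] r(1) s(1) by (simp add: abs_mult)
  also have "\<dots> \<le> (\<bar>a\<bar> + b) * (\<bar>c\<bar> + d)" by (simp add: algebra_simps)
  also have "\<dots> \<le> 2 ^ k * 2 ^ l" using r s by (intro mult_mono) auto
  finally have "\<bar>a * d + c * b\<bar> + b * d \<le> 2 ^ (k + l)" by (simp add: power_add)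
  moreover have "r + s = of_int (a * d + c * b) / of_int (b * d)"
    using r s by (simp add: field_simps)
  ultimately show ?thesis unfolding fits_def using r(1) s(1) by (metis mult_pos_pos)
qed

lemma fits_diff:
  assumes "fits r k" "fits s l"
  shows "fits (r - s) (k + l)"
proof -
  have "fits (- s) l"
  proof -
    obtain a b where "0 < b" "s = of_int a / of_int b" "\<bar>a\<bar> + b \<le> 2 ^ l"
      using assms(2) unfolding fits_def by blast
    then show ?thesis unfolding fits_def by (intro exI[of _ "- a"] exI[of _ b]) simp
  qed
  from fits_add[OF assms(1) this] show ?thesis by simp
qed

lemma fits_mult:
  assumes "fits r k" "fits s l"
  shows "fits (r * s) (k + l)"
proof -
  obtain a b c d where r: "0 < b" "r = of_int a / of_int b" "\<bar>a\<bar> + b \<le> 2 ^ k"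
    and s: "0 < d" "s = of_int c / of_int d" "\<bar>c\<bar> + d \<le> 2 ^ l"
    using assms unfolding fits_def by blast
  have "\<bar>a * c\<bar> + b * d \<le> (\<bar>a\<bar> + b) * (\<bar>c\<bar> + d)"
    using r(1) s(1) by (simp add: algebra_simps abs_mult)
  also have "\<dots> \<le> 2 ^ k * 2 ^ l" using r s by (intro mult_mono) auto
  finally have "\<bar>a * c\<bar> + b * d \<le> 2 ^ (k + l)" by (simp add: power_add)
  moreover have "r * s = of_int (a * c) / of_int (b * d)"
    using r s by simp
  ultimately show ?thesis unfolding fits_def using r(1) s(1) by (metis mult_pos_pos)
qed

lemma fits_sum:
  assumes "finite S" "\<And>i. i \<in> S \<Longrightarrow> fits (f i) (k i)"
  shows "fits (\<Sum>i\<in>S. f i) (\<Sum>i\<in>S. k i)"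
  using assms by (induction rule: finite_induct) (auto simp: fits_0 intro: fits_add)

text \<open>
  The denominators of all entries are multiplied up, so the size of the value is linear in the
  number of input bits, with no extra term for the number of summands.
\<close>

lemma fits_scalar_prod:
  assumes "dim_vec a = dim_vec x"
  shows "fits (a \<bullet> x) (vec_bits a + vec_bits x)"
proof -
  have "fits (\<Sum>i<dim_vec x. a $ i * x $ i) (\<Sum>i<dim_vec x. rat_bits (a $ i) + rat_bits (x $ i))"
    by (intro fits_sum fits_mult fits_rat_bits) auto
  then show ?thesis
    by (simp add: scalar_prod_def vec_bits_def assms sum.distrib atLeast0LessThan)
qed

text \<open>
  Written as \<open>\<Sum>\<^sub>i x\<^sub>i (row\<^sub>i \<bullet> x)\<close>, the form uses \<open>x\<close> once for the outer factors and once for each of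
  the \<open>n\<close> rows.
\<close>

lemma fits_quad_form:
  assumes "Q \<in> carrier_mat n n" "x \<in> carrier_vec n"
  shows "fits (quad_form Q x) (mat_bits Q + (n + 1) * vec_bits x)"
proof -
  have "fits (\<Sum>i<n. x $ i * (row Q i \<bullet> x))
      (\<Sum>i<n. rat_bits (x $ i) + (vec_bits (row Q i) + vec_bits x))"
    using assms by (intro fits_sum fits_mult fits_rat_bits fits_scalar_prod) auto
  moreover have "(\<Sum>i<n. vec_bits (row Q i)) = mat_bits Q"
    using assms by (auto simp: vec_bits_def mat_bits_def intro!: sum.cong)
  moreover have "quad_form Q x = (\<Sum>i<n. x $ i * (row Q i \<bullet> x))"
    using assms by (auto simp: quad_form_def scalar_prod_def[of x] atLeast0LessThan intro!: sum.cong)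
  moreover have "(\<Sum>i<n. rat_bits (x $ i)) = vec_bits x"
    using assms by (simp add: vec_bits_def)
  ultimately show ?thesis by (simp add: sum.distrib algebra_simps)
qed

section \<open>Enumerating the lattice points of the 1-norm ball\<close>

definition int_ball :: "nat \<Rightarrow> nat \<Rightarrow> int vec set" where
  "int_ball n L = {x \<in> carrier_vec n. l1_norm x \<le> int L}"

lemma l1_norm_eq_sum_nat: "l1_norm x = int (\<Sum>i<dim_vec x. nat \<bar>x $ i\<bar>)"
  by (simp add: l1_norm_def)

text \<open>
  Even a zero entry takes three bits, which is where \<open>3n\<close> comes from; beyond that, the nonzero
  entries share a total magnitude of at most \<open>L\<close>.
\<close>

lemma vec_bits_int_ball:
  assumes "x \<in> int_ball n L"
  shows "vec_bits (rat_vec x) \<le> 3 * n + L"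
proof -
  have n: "dim_vec x = n" and l: "l1_norm x \<le> int L" using assms by (auto simp: int_ball_def)
  have "vec_bits (rat_vec x) = (\<Sum>i<n. rat_bits (of_int (x $ i)))"
    unfolding vec_bits_def by (rule sum.cong) (simp_all add: n)
  also have "\<dots> \<le> (\<Sum>i<n. 3 + nat \<bar>x $ i\<bar>)"
    by (intro sum_mono rat_bits_of_int_le)
  also have "\<dots> = 3 * n + (\<Sum>i<n. nat \<bar>x $ i\<bar>)" by (simp add: sum.distrib)
  also have "(\<Sum>i<n. nat \<bar>x $ i\<bar>) \<le> L"
    using l by (simp only: l1_norm_eq_sum_nat n of_nat_le_iff)
  finally show ?thesis by simp
qed

lemma abs_nth_le_l1_norm: "i < dim_vec x \<Longrightarrow> \<bar>x $ i\<bar> \<le> l1_norm x"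
  unfolding l1_norm_def by (rule member_le_sum) auto

lemma msets_mono:
  assumes "u \<in> msets n N" "i \<le> j" "j < n"
  shows "u $ i \<le> u $ j"
  using assms(2,3)
proof (induction j rule: dec_induct)
  case (step j)
  have "u $ j \<le> u $ Suc j" using assms(1) step by (simp add: msets_def)
  then show ?case using step by simp
qed simp

lemma dim_phi [simp]: "dim_vec (phi u) = dim_vec u"
  by (simp add: phi_def)

text \<open>
  The differences telescope; \<open>phi\<close> measures the first component against the smallest value 1, hence
  the shift.
\<close>

lemma sum_phi:
  assumes "u \<in> msets n N" "k < n"
  shows "(\<Sum>i<Suc k. phi u $ i) + 1 = u $ k"
  using assms(2)
proof (induction k)
  case 0
  then show ?case using assms(1) by (auto simp: phi_def msets_def)
next
  case (Suc k)
  have "u $ k \<le> u $ Suc k" "dim_vec u = n" using assms(1) Suc.prems by (auto simp: msets_def)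
  then show ?case using Suc by (simp add: phi_def)
qed

lemma sum_phi_le:
  assumes "u \<in> msets n (L + 1)"
  shows "(\<Sum>i<n. phi u $ i) \<le> L"
proof (cases n)
  case (Suc k)
  have "u $ k \<le> L + 1" using assms Suc by (auto simp: msets_def)
  then show ?thesis using sum_phi[OF assms, of k] Suc by simp
qed simp

text \<open>
  Partial sums invert the difference map, so every nonnegative vector of 1-norm at most \<open>L\<close> comes
  from a multiset.
\<close>

lemma phi_partial_sums:
  assumes v: "v \<in> carrier_vec n" and le: "(\<Sum>i<n. v $ i) \<le> L"
  obtains u where "u \<in> msets n (L + 1)" "phi u = v"
proof
  let ?u = "vec n (\<lambda>i. 1 + (\<Sum>j<Suc i. v $ j))"
  have "(\<Sum>j<Suc i. v $ j) \<le> L" if "i < n" for i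
    using sum_mono2[of "{..<n}" "{..<Suc i}" "\<lambda>j. v $ j"] that le by auto
  then show "?u \<in> msets n (L + 1)"
    by (auto simp: msets_def simp del: sum.lessThan_Suc) simp
  show "phi ?u = v"
  proof (rule eq_vecI)
    fix i assume "i < dim_vec v"
    then show "phi ?u $ i = v $ i"
      using v by (cases i) (auto simp: phi_def)
  qed (use v in simp)
qed

text \<open>
  Here the enumeration is seen to be complete: \<open>phi\<close> yields the vector of absolute values of a point
  and the sign permutation its signs.
\<close>

lemma visited_points:
  "(\<Union>u\<in>msets n (L + 1). hadamard (phi u) ` sign_perm (support_vec (phi u))) = int_ball n L"
proof (intro equalityI subsetI)
  fix x assume "x \<in> (\<Union>u\<in>msets n (L + 1). hadamard (phi u) ` sign_perm (support_vec (phi u)))"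
  then obtain u \<sigma> where u: "u \<in> msets n (L + 1)"
    and \<sigma>: "\<sigma> \<in> sign_perm (support_vec (phi u))" and x: "x = hadamard (phi u) \<sigma>" by blast
  have n: "dim_vec u = n" using u by (simp add: msets_def)
  have "\<bar>int (phi u $ i) * \<sigma> $ i\<bar> \<le> int (phi u $ i)" if "i < n" for i
    using \<sigma> that by (auto simp: sign_perm_def support_vec_def n abs_mult split: if_splits)
  then have "(\<Sum>i<n. \<bar>int (phi u $ i) * \<sigma> $ i\<bar>) \<le> (\<Sum>i<n. int (phi u $ i))"
    by (intro sum_mono) auto
  also have "\<dots> \<le> int L" using sum_phi_le[OF u] by (metis of_nat_le_iff of_nat_sum)
  also have "(\<Sum>i<n. \<bar>int (phi u $ i) * \<sigma> $ i\<bar>) = l1_norm x"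
    unfolding l1_norm_def x hadamard_def by (simp add: n)
  finally show "x \<in> int_ball n L"
    unfolding int_ball_def x hadamard_def by (simp add: n)
next
  fix x assume x: "x \<in> int_ball n L"
  let ?v = "vec n (\<lambda>i. nat \<bar>x $ i\<bar>)"
  have n: "dim_vec x = n" using x by (simp add: int_ball_def)
  have "l1_norm x \<le> int L" using x by (simp add: int_ball_def)
  then have "(\<Sum>i<n. nat \<bar>x $ i\<bar>) \<le> L" by (simp only: l1_norm_eq_sum_nat n of_nat_le_iff)
  then have "(\<Sum>i<n. ?v $ i) \<le> L" by simp
  then obtain u where u: "u \<in> msets n (L + 1)" "phi u = ?v"
    using phi_partial_sums[of ?v n L] by auto
  have "x = hadamard ?v (map_vec sgn x)"
    by (rule eq_vecI) (auto simp: hadamard_def n abs_mult_sgn)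
  moreover have "map_vec sgn x \<in> carrier_vec (dim_vec (support_vec ?v))"
    by (rule carrier_vecI) (simp add: support_vec_def n)
  then have "map_vec sgn x \<in> sign_perm (support_vec ?v)"
    by (auto simp: sign_perm_def support_vec_def n sgn_if split: if_splits)
  ultimately have "x \<in> hadamard ?v ` sign_perm (support_vec ?v)" by (rule image_eqI)
  then have "x \<in> hadamard (phi u) ` sign_perm (support_vec (phi u))" by (simp only: u(2))
  with u(1) show "x \<in> (\<Union>u\<in>msets n (L + 1). hadamard (phi u) ` sign_perm (support_vec (phi u)))"
    by (rule UN_I)
qed

section \<open>Number of iterations\<close>

text \<open>
  A nondecreasing vector with values in \<open>{1..L + 1}\<close> is determined by the \<open>L\<close> positions at which it
  first exceeds \<open>1, \<dots>, L\<close>, each of which lies in \<open>{0..n}\<close>. This makes the count polynomial in \<open>n\<close>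
  for fixed \<open>L\<close>.
\<close>

lemma card_msets_le: "card (msets n (L + 1)) \<le> (n + 1) ^ L"
proof -
  (* the first position exceeding j; the alternative i = n covers vectors that never do *)
  define c where "c = (\<lambda>u::nat vec. \<lambda>j\<in>{1..L}. LEAST i. i = n \<or> j < u $ i)"
  have le: "(LEAST i. i = n \<or> j < u $ i) \<le> n" for u :: "nat vec" and j
    by (rule Least_le) simp
  have c_iff: "i < c u j \<longleftrightarrow> u $ i \<le> j" if "u \<in> msets n (L + 1)" "i < n" "j \<in> {1..L}" for u i j
  proof
    assume "i < c u j"
    then have "i < (LEAST i. i = n \<or> j < u $ i)" using that by (simp add: c_def)
    from not_less_Least[OF this] show "u $ i \<le> j" by auto
  next
    assume *: "u $ i \<le> j"
    have "c u j = n \<or> j < u $ c u j"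
      using LeastI[of "\<lambda>i. i = n \<or> j < u $ i" n] that by (simp add: c_def)
    then show "i < c u j"
      using msets_mono[OF that(1) _ that(2), of "c u j"] * that(2) by force
  qed
  have "inj_on c (msets n (L + 1))"
  proof (rule inj_onI)
    fix u w assume u: "u \<in> msets n (L + 1)" and w: "w \<in> msets n (L + 1)" and eq: "c u = c w"
    have "u $ i = w $ i" if i: "i < n" for i
    proof -
      have iff: "u $ i \<le> j \<longleftrightarrow> w $ i \<le> j" if "j \<in> {1..L}" for j
        using c_iff[OF u i that] c_iff[OF w i that] eq by simp
      have "u $ i \<in> {1..L + 1}" "w $ i \<in> {1..L + 1}" using u w i by (auto simp: msets_def)
      then show ?thesis
        using iff[of "u $ i"] iff[of "w $ i"] by (cases "u $ i \<le> w $ i") force+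
    qed
    then show "u = w" using u w by (intro eq_vecI) (auto simp: msets_def)
  qed
  moreover have "c ` msets n (L + 1) \<subseteq> {1..L} \<rightarrow>\<^sub>E {0..n}"
    using le by (auto simp: c_def)
  moreover have "finite ({1..L} \<rightarrow>\<^sub>E {0..n})" by (intro finite_PiE) auto
  ultimately have "card (msets n (L + 1)) \<le> card ({1..L} \<rightarrow>\<^sub>E {0..n})"
    by (rule card_inj_on_le)
  then show ?thesis by (simp add: card_PiE)
qed

text \<open>
  A sign permutation is the choice of the positive positions within the support, and the support has
  at most \<open>L\<close> elements because every entry in it contributes at least 1 to the sum.
\<close>

lemma card_sign_perm_le:
  assumes "(\<Sum>i<dim_vec v. v $ i) \<le> L"
  shows "card (sign_perm (support_vec v)) \<le> 2 ^ L"
proof -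
  let ?S = "{i. i < dim_vec v \<and> v $ i \<noteq> 0}"
  have "inj_on (\<lambda>\<sigma>. {i \<in> ?S. \<sigma> $ i = 1}) (sign_perm (support_vec v))"
  proof (rule inj_onI)
    fix \<sigma> \<tau> assume s: "\<sigma> \<in> sign_perm (support_vec v)" and t: "\<tau> \<in> sign_perm (support_vec v)"
      and eq: "{i \<in> ?S. \<sigma> $ i = 1} = {i \<in> ?S. \<tau> $ i = 1}"
    have "\<sigma> $ i = \<tau> $ i" if "i < dim_vec v" for i
    proof (cases "v $ i = 0")
      case True
      then show ?thesis using s t that by (auto simp: sign_perm_def support_vec_def)
    next
      case False
      then have "\<sigma> $ i \<in> {-1, 1}" "\<tau> $ i \<in> {-1, 1}"
        using s t that by (auto simp: sign_perm_def support_vec_def)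
      moreover have "\<sigma> $ i = 1 \<longleftrightarrow> \<tau> $ i = 1" using eq False that by blast
      ultimately show ?thesis by auto
    qed
    then show "\<sigma> = \<tau>" using s t by (intro eq_vecI) (auto simp: sign_perm_def support_vec_def)
  qed
  then have "card (sign_perm (support_vec v)) \<le> card (Pow ?S)"
    by (rule card_inj_on_le) auto
  also have "\<dots> = 2 ^ card ?S" by (simp add: card_Pow)
  also have "\<dots> \<le> 2 ^ L"
  proof (rule power_increasing)
    have "card ?S = (\<Sum>i\<in>?S. 1)" by simp
    also have "\<dots> \<le> (\<Sum>i\<in>?S. v $ i)" by (intro sum_mono) auto
    also have "\<dots> \<le> (\<Sum>i<dim_vec v. v $ i)" by (rule sum_mono2) auto
    finally show "card ?S \<le> L" using assms by simp
  qed simp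
  finally show ?thesis .
qed

section \<open>Correctness and running time for bounded evaluations\<close>

lemma sum_le_card_mult:
  fixes f :: "nat \<Rightarrow> nat"
  assumes "\<And>i. i < n \<Longrightarrow> f i \<le> c"
  shows "(\<Sum>i<n. f i) \<le> n * c"
  using sum_bounded_above[of "{..<n}" f c] assms by simp

text \<open>
  The common shape of the two nested loops of the algorithm: \<open>S\<close> stands for the points visited so
  far, \<open>t\<close> for a time budget, and one iteration may spend \<open>V\<close>.
\<close>

lemma fold_invariant_time:
  assumes "R s {} t"
    and "\<And>x s S t. x \<in> set xs \<Longrightarrow> R s S t \<Longrightarrow> R (f x s) (S \<union> g x) (t + V)"
  shows "R (fold f xs s) (\<Union>x\<in>set xs. g x) (t + length xs * (V :: nat))"
proof -
  have "R (fold f xs s) (S \<union> (\<Union>x\<in>set xs. g x)) (t + length xs * V)" if "R s S t" for S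
    using that assms(2)
  proof (induction xs arbitrary: s S t)
    case (Cons x xs)
    have "R (f x s) (S \<union> g x) (t + V)" by (rule Cons.prems) (use Cons.prems in auto)
    from Cons.IH[OF this Cons.prems(2)] show ?case by (simp add: Un_assoc ac_simps)
  qed simp
  from this[OF assms(1)] show ?thesis by simp
qed

text \<open>
  \<^const>\<open>solves\<close> with the feasible set replaced by the feasible points of an arbitrary set \<open>S\<close>, so that
  it can serve as the loop invariant with \<open>S\<close> the set of points visited so far.
\<close>

definition incumbent_for :: "int_prog \<Rightarrow> int vec set \<Rightarrow> incumbent \<Rightarrow> bool" where
  "incumbent_for P S r \<longleftrightarrow>
     (let F = {x \<in> S. ip_con P x \<le> 0\<^sub>v (ip_ncon P)} in
      if F = {} then r = (None, None)
      else \<exists>x. is_arg_min (ip_obj P) (\<lambda>y. y \<in> F) x \<and> r = (Some x, Some (ip_obj P x)))"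

lemma solves_iff_incumbent_for:
  assumes "0 \<le> l"
  shows "solves P l r \<longleftrightarrow> incumbent_for P (int_ball (ip_dim P) (nat \<lfloor>l\<rfloor>)) r"
proof -
  have "of_int (l1_norm x) \<le> l \<longleftrightarrow> l1_norm x \<le> int (nat \<lfloor>l\<rfloor>)" for x
    using assms by (simp add: le_floor_iff)
  then have "feasible P l =
      {x \<in> int_ball (ip_dim P) (nat \<lfloor>l\<rfloor>). ip_con P x \<le> 0\<^sub>v (ip_ncon P)}"
    by (auto simp: feasible_def int_ball_def)
  then show ?thesis by (simp only: solves_def incumbent_for_def Let_def)
qed

lemma incumbent_for_insert:
  assumes "incumbent_for P S (xs, fs)"
  shows "incumbent_for P (insert x S)
    (if (case fs of None \<Rightarrow> True | Some f \<Rightarrow> ip_obj P x < f) \<and> ip_con P x \<le> 0\<^sub>v (ip_ncon P)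
     then (Some x, Some (ip_obj P x)) else (xs, fs))"
proof -
  define F where "F = {y \<in> S. ip_con P y \<le> 0\<^sub>v (ip_ncon P)}"
  define F' where "F' = {y \<in> insert x S. ip_con P y \<le> 0\<^sub>v (ip_ncon P)}"
  have F': "F' = (if ip_con P x \<le> 0\<^sub>v (ip_ncon P) then insert x F else F)"
    by (auto simp: F_def F'_def)
  show ?thesis
    using assms unfolding incumbent_for_def Let_def F_def[symmetric] F'_def[symmetric]
    by (auto simp: F' is_arg_min_def split: if_splits)
qed

text \<open>
  The cost conventions with a natural constant and with the logarithms relaxed to the identity. This
  loses nothing, because every visit is also charged for one multiplication per coordinate.
\<close>

locale exec_costs =
  fixes E :: exec_model and K :: nat
  assumes valid_orders: "valid_orders E"
    and mset_cost_le: "u \<in> msets k N \<Longrightarrow> mset_cost E k N u \<le> K * (1 + N)"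
    and sign_cost_le:
      "binary_vec b \<Longrightarrow> \<sigma> \<in> sign_perm b \<Longrightarrow> sign_cost E b \<sigma> \<le> K * (1 + dim_vec b)"
    and op_cost_le: "op_cost E oper rs \<le> K * (1 + (\<Sum>r\<leftarrow>rs. rat_bits r))\<^sup>2"
    and dot_cost_le: "a \<in> carrier_vec n \<Longrightarrow> x \<in> carrier_vec n \<Longrightarrow> vec_bits a \<le> s \<Longrightarrow>
      vec_bits x \<le> s \<Longrightarrow> dot_cost E a x \<le> K * s\<^sup>2 * n"
    and quad_cost_le: "Q \<in> carrier_mat n n \<Longrightarrow> x \<in> carrier_vec n \<Longrightarrow> mat_bits Q \<le> s \<Longrightarrow>
      vec_bits x \<le> s \<Longrightarrow> quad_cost E Q x \<le> K * s\<^sup>2 * n\<^sup>2"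
begin

lemma op_cost_le_bits:
  assumes "(\<Sum>r\<leftarrow>rs. rat_bits r) \<le> k"
  shows "op_cost E oper rs \<le> K * (1 + k)\<^sup>2"
  using op_cost_le[of oper rs] assms
  by (meson add_left_mono le_trans mult_left_mono power_mono zero_le)

end

text \<open>
  Rounding the real constant up to a natural one keeps all later estimates within the naturals.
\<close>

lemma exec_costs_ex:
  assumes "valid_orders E" "cost_conventions E"
  obtains K where "exec_costs E K"
proof -
  from assms(2) obtain K :: real where K: "
      (\<forall>k N. \<forall>u\<in>msets k N. mset_cost E k N u \<le> K * (1 + log 2 N)) \<and>
      (\<forall>b. binary_vec b \<longrightarrow> (\<forall>\<sigma>\<in>sign_perm b. sign_cost E b \<sigma> \<le> K * (1 + log 2 (dim_vec b)))) \<and>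
      (\<forall>oper rs. op_cost E oper rs \<le> K * (1 + real (\<Sum>r\<leftarrow>rs. rat_bits r))\<^sup>2) \<and>
      (\<forall>n s. \<forall>a\<in>carrier_vec n. \<forall>x\<in>carrier_vec n. vec_bits a \<le> s \<longrightarrow> vec_bits x \<le> s \<longrightarrow>
        dot_cost E a x \<le> K * (real s)\<^sup>2 * real n) \<and>
      (\<forall>n s. \<forall>Q\<in>carrier_mat n n. \<forall>x\<in>carrier_vec n. mat_bits Q \<le> s \<longrightarrow> vec_bits x \<le> s \<longrightarrow>
        quad_cost E Q x \<le> K * (real s)\<^sup>2 * (real n)\<^sup>2)"
    unfolding cost_conventions_def ..
  note K = K[THEN conjunct1, rule_format] K[THEN conjunct2, THEN conjunct1, rule_format]
    K[THEN conjunct2, THEN conjunct2, THEN conjunct1, rule_format]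
    K[THEN conjunct2, THEN conjunct2, THEN conjunct2, THEN conjunct1, rule_format]
    K[THEN conjunct2, THEN conjunct2, THEN conjunct2, THEN conjunct2, rule_format]
  define K' where "K' = nat \<lceil>K\<rceil>"
  have KK': "K \<le> real K'" unfolding K'_def by (rule real_nat_ceiling_ge)
  have bound: "c \<le> K' * y" if "real c \<le> K * x" "0 \<le> x" "x \<le> real y" for c y :: nat and x :: real
  proof -
    have "real c \<le> real K' * real y"
      using that KK' by (meson mult_mono of_nat_0_le_iff order_trans)
    then show ?thesis by (metis of_nat_le_iff of_nat_mult)
  qed
  have log0: "0 \<le> log 2 (real N)" and log_le: "log 2 (real N) \<le> real N" for N
  proof -
    show "0 \<le> log 2 (real N)" by (cases "N = 0") (auto simp: log_def)
    have "real N \<le> 2 ^ N" by (rule less_imp_le[OF of_nat_less_two_power])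
    then show "log 2 (real N) \<le> real N"
      by (cases "N = 0") (auto simp: log_def[of _ 0] intro: log_of_power_le)
  qed
  have "exec_costs E K'"
  proof
    show "valid_orders E" by fact
  next
    fix k N u assume "u \<in> msets k N"
    then show "mset_cost E k N u \<le> K' * (1 + N)"
      by (intro bound[OF K(1)]) (use log0[of N] log_le[of N] in auto)
  next
    fix b \<sigma> assume "binary_vec b" "\<sigma> \<in> sign_perm b"
    then show "sign_cost E b \<sigma> \<le> K' * (1 + dim_vec b)"
      by (intro bound[OF K(2)]) (use log0[of "dim_vec b"] log_le[of "dim_vec b"] in auto)
  next
    fix oper rs
    show "op_cost E oper rs \<le> K' * (1 + (\<Sum>r\<leftarrow>rs. rat_bits r))\<^sup>2"
      by (rule bound[OF K(3)]) auto
  next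
    fix a x n s
    assume "a \<in> carrier_vec n" "x \<in> carrier_vec n" "vec_bits a \<le> s" "vec_bits x \<le> s"
    from K(4)[OF this] have "dot_cost E a x \<le> K' * (s\<^sup>2 * n)"
      unfolding mult.assoc by (rule bound) auto
    then show "dot_cost E a x \<le> K' * s\<^sup>2 * n" by (simp add: mult.assoc)
  next
    fix Q x n s
    assume "Q \<in> carrier_mat n n" "x \<in> carrier_vec n" "mat_bits Q \<le> s" "vec_bits x \<le> s"
    from K(5)[OF this] have "quad_cost E Q x \<le> K' * (s\<^sup>2 * n\<^sup>2)"
      unfolding mult.assoc by (rule bound) auto
    then show "quad_cost E Q x \<le> K' * s\<^sup>2 * n\<^sup>2" by (simp add: mult.assoc)
  qed
  then show thesis by (rule that)
qed

definition run_factor :: "nat \<Rightarrow> nat \<Rightarrow> nat" where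
  "run_factor K L = 2 ^ L * (1 + 9 * K * (2 * L + 9)\<^sup>2)"

text \<open>
  What an application has to supply: uniform bounds, over all lattice points of the ball, for the
  cost \<open>T\<close> of evaluating objective and constraints and for the bit size \<open>B\<close> of each value.
\<close>

locale bounded_run = exec_costs +
  fixes P :: int_prog and cf cg :: "int vec \<Rightarrow> nat" and L T B :: nat
  assumes con_dim: "x \<in> int_ball (ip_dim P) L \<Longrightarrow> ip_con P x \<in> carrier_vec (ip_ncon P)"
    and eval_cost_le: "x \<in> int_ball (ip_dim P) L \<Longrightarrow> cf x + cg x \<le> T"
    and obj_bits_le: "x \<in> int_ball (ip_dim P) L \<Longrightarrow> rat_bits (ip_obj P x) \<le> B"
    and con_bits_le:
      "x \<in> int_ball (ip_dim P) L \<Longrightarrow> i < ip_ncon P \<Longrightarrow> rat_bits (ip_con P x $ i) \<le> B"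
begin

text \<open>
  Up to the factor \<open>K\<close>, \<open>W\<close> pays for one operation on the small integers handled by the enumeration
  itself (multisets, differences, signs, coordinates), which are bounded in terms of \<open>L\<close>. \<open>M\<close> pays
  for handling the coordinates and comparing the values of a single point.
\<close>

definition W :: nat where "W = (2 * L + 9)\<^sup>2"

definition M :: nat where "M = (ip_dim P + ip_ncon P + 1) * (B + 1)\<^sup>2"

definition invar :: "incumbent \<times> nat \<Rightarrow> int vec set \<Rightarrow> nat \<Rightarrow> bool" where
  "invar s S t \<longleftrightarrow> S \<subseteq> int_ball (ip_dim P) L \<and> incumbent_for P S (fst s) \<and> snd s \<le> t"

lemma invar_mono: "invar s S t \<Longrightarrow> t \<le> t' \<Longrightarrow> invar s S t'"
  by (auto simp: invar_def)

lemma small_op_cost: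
  assumes "(\<Sum>r\<leftarrow>rs. rat_bits r) \<le> 2 * L + 8"
  shows "op_cost E oper rs \<le> K * W"
  using op_cost_le_bits[OF assms, of oper] by (simp add: W_def add.commute)

lemma large_op_cost:
  assumes "(\<Sum>r\<leftarrow>rs. rat_bits r) \<le> 2 * B + 3"
  shows "op_cost E oper rs \<le> K * (16 * (B + 1)\<^sup>2)"
proof -
  have "(1 + (2 * B + 3))\<^sup>2 \<le> (4 * (B + 1))\<^sup>2" by (intro power_mono) auto
  also have "\<dots> = 16 * (B + 1)\<^sup>2" by (simp add: power2_eq_square algebra_simps)
  finally show ?thesis
    using op_cost_le_bits[OF assms, of oper] by (meson le_trans mult_left_mono zero_le)
qed

text \<open>
  The stored value \<open>f\<^sup>*\<close> enters the cost of the comparison. It obeys the same size bound as the current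
  value, because it is the objective at a point visited earlier; hence the invariant must carry
  \<open>S \<subseteq> int_ball\<close> along.
\<close>

lemma visit_invar:
  assumes inv: "invar s S t"
    and v: "dim_vec v = ip_dim P" "\<And>i. i < ip_dim P \<Longrightarrow> v $ i \<le> L"
    and \<sigma>: "\<sigma> \<in> sign_perm (support_vec v)"
    and x: "hadamard v \<sigma> \<in> int_ball (ip_dim P) L"
  shows "invar (visit E P cf cg v (support_vec v) \<sigma> s) (S \<union> {hadamard v \<sigma>}) (t + (T + 4 * K * W * M))"
proof -
  obtain xs fs t0 where s: "s = ((xs, fs), t0)" by (metis surj_pair)
  let ?n = "ip_dim P" and ?x = "hadamard v \<sigma>" and ?y = "ip_obj P (hadamard v \<sigma>)"
    and ?z = "ip_con P (hadamard v \<sigma>)" and ?b = "support_vec v"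
  have S: "S \<subseteq> int_ball ?n L" and inc: "incumbent_for P S (xs, fs)" and t0: "t0 \<le> t"
    using inv by (auto simp: invar_def s)
  have B: "rat_bits ?y \<le> B" by (rule obj_bits_le[OF x])
  have fs: "rat_bits f \<le> B" if f: "fs = Some f" for f
  proof -
    obtain x' where "x' \<in> S" "f = ip_obj P x'"
      using inc f by (auto simp: incumbent_for_def is_arg_min_def Let_def split: if_splits)
    then show ?thesis using obj_bits_le S by auto
  qed
  have "binary_vec ?b" by (simp add: binary_vec_def support_vec_def)
  from sign_cost_le[OF this \<sigma>] have c1: "sign_cost E ?b \<sigma> \<le> K * (1 + ?n)"
    by (simp add: support_vec_def v)
  have c2: "(\<Sum>i<dim_vec v. op_cost E Mul [of_nat (v $ i), of_int (\<sigma> $ i)]) \<le> ?n * (K * W)"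
    unfolding v(1)
  proof (intro sum_le_card_mult small_op_cost)
    fix i assume i: "i < ?n"
    have "nat \<bar>\<sigma> $ i\<bar> \<le> 1"
      using \<sigma> i by (auto simp: sign_perm_def support_vec_def v split: if_splits)
    then have "rat_bits (rat_of_int (\<sigma> $ i)) \<le> 4"
      using rat_bits_of_int_le[of "\<sigma> $ i"] by simp
    moreover have "rat_bits (rat_of_nat (v $ i)) \<le> 3 + L"
      using rat_bits_of_nat_le[of "v $ i"] v(2)[OF i] by simp
    ultimately show "(\<Sum>r\<leftarrow>[rat_of_nat (v $ i), of_int (\<sigma> $ i)]. rat_bits r) \<le> 2 * L + 8" by simp
  qed
  have c3: "op_cost E Cmp (case fs of None \<Rightarrow> [?y] | Some f \<Rightarrow> [?y, f]) \<le> K * (16 * (B + 1)\<^sup>2)"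
    by (rule large_op_cost) (use B fs in \<open>auto split: option.splits\<close>)
  have dim_z: "dim_vec ?z = ip_ncon P" using con_dim[OF x] by simp
  have c4: "(\<Sum>i<dim_vec ?z. op_cost E Cmp [?z $ i, 0]) \<le> ip_ncon P * (K * (16 * (B + 1)\<^sup>2))"
  proof -
    have "op_cost E Cmp [?z $ i, 0] \<le> K * (16 * (B + 1)\<^sup>2)" if "i < ip_ncon P" for i
      using con_bits_le[OF x that] rat_bits_of_int_le[of 0] by (intro large_op_cost) simp
    then show ?thesis
      unfolding dim_z by (rule sum_le_card_mult)
  qed
  have c5: "(\<Sum>i<dim_vec ?x. op_cost E Assign [of_int (?x $ i)]) \<le> ?n * (K * W)"
  proof -
    have d: "dim_vec ?x = ?n" by (simp add: hadamard_def v)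
    have "rat_bits (rat_of_int (?x $ i)) \<le> 2 * L + 8" if "i < ?n" for i
      using rat_bits_of_int_le[of "?x $ i"] abs_nth_le_l1_norm[of i ?x] x that
      by (auto simp: int_ball_def d)
    then show ?thesis unfolding d by (intro sum_le_card_mult small_op_cost) auto
  qed
  have c6: "op_cost E Assign [?y] \<le> K * (16 * (B + 1)\<^sup>2)"
    by (rule large_op_cost) (use B in auto)
  define time where "time = sign_cost E ?b \<sigma>
           + (\<Sum>i<dim_vec v. op_cost E Mul [of_nat (v $ i), of_int (\<sigma> $ i)])
           + cf ?x + cg ?x
           + op_cost E Cmp (case fs of None \<Rightarrow> [?y] | Some f \<Rightarrow> [?y, f])
           + (\<Sum>i<dim_vec ?z. op_cost E Cmp [?z $ i, 0])
           + (if (case fs of None \<Rightarrow> True | Some f \<Rightarrow> ?y < f) \<and> ?z \<le> 0\<^sub>v (ip_ncon P)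
              then (\<Sum>i<dim_vec ?x. op_cost E Assign [of_int (?x $ i)]) + op_cost E Assign [?y]
              else 0)"
  have "time \<le> T + K * (1 + ?n + 2 * ?n * W + (ip_ncon P + 2) * (16 * (B + 1)\<^sup>2))"
    using c1 c2 eval_cost_le[OF x] c3 c4 c5 c6 by (auto simp: time_def algebra_simps)
  also have "\<dots> \<le> T + K * (4 * W * M)"
  proof -
    have "1 \<le> (B + 1)\<^sup>2" by simp
    then have nM: "1 + ?n \<le> M" and m: "(ip_ncon P + 1) * (B + 1)\<^sup>2 \<le> M"
      using mult_le_mono[of "1 + ?n" "ip_dim P + ip_ncon P + 1" 1 "(B + 1)\<^sup>2"]
        mult_le_mono1[of "ip_ncon P + 1" "ip_dim P + ip_ncon P + 1" "(B + 1)\<^sup>2"]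
      by (simp_all add: M_def)
    have W: "81 \<le> W" using power_mono[of 9 "2 * L + 9" 2] by (simp add: W_def)
    have "(ip_ncon P + 2) * (16 * (B + 1)\<^sup>2) \<le> 32 * ((ip_ncon P + 1) * (B + 1)\<^sup>2)"
      by (simp add: algebra_simps)
    also have "\<dots> \<le> 32 * M" using m by simp
    finally have "(ip_ncon P + 2) * (16 * (B + 1)\<^sup>2) \<le> 32 * M" .
    moreover have "2 * ?n * W \<le> 2 * W * M"
      using mult_le_mono2[of ?n M "2 * W"] nM by (simp only: ac_simps)
    moreover have "33 * M \<le> 2 * W * M"
      using W by (intro mult_le_mono1) simp
    ultimately have "1 + ?n + 2 * ?n * W + (ip_ncon P + 2) * (16 * (B + 1)\<^sup>2) \<le> 4 * W * M"
      using nM by linarith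
    then show ?thesis by (intro add_left_mono mult_le_mono2)
  qed
  finally have "time \<le> T + 4 * K * W * M" by (simp add: ac_simps)
  moreover have "visit E P cf cg v ?b \<sigma> s =
      (if (case fs of None \<Rightarrow> True | Some f \<Rightarrow> ?y < f) \<and> ?z \<le> 0\<^sub>v (ip_ncon P)
       then (Some ?x, Some ?y) else (xs, fs), t0 + time)"
    unfolding visit_def s Let_def prod.case time_def ..
  ultimately show ?thesis
    using incumbent_for_insert[OF inc, of ?x] S x t0 by (auto simp: invar_def)
qed

lemma process_mset_invar:
  assumes inv: "invar s S t" and u: "u \<in> msets (ip_dim P) (L + 1)"
  shows "invar (process_mset E P cf cg (L + 1) u s)
    (S \<union> hadamard (phi u) ` sign_perm (support_vec (phi u)))
    (t + (4 * K * W * M + 2 ^ L * (T + 4 * K * W * M)))"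
proof -
  let ?n = "ip_dim P" and ?v = "phi u" and ?b = "support_vec (phi u)" and ?V = "T + 4 * K * W * M"
  obtain r t0 where s: "s = (r, t0)" by fastforce
  have n: "dim_vec u = ?n" using u by (simp add: msets_def)
  have u_le: "u $ i \<le> L + 1" if "i < ?n" for i using u that by (auto simp: msets_def)
  have v_le: "?v $ i \<le> L" if "i < ?n" for i
    using member_le_sum[of i "{..<?n}" "\<lambda>i. ?v $ i"] sum_phi_le[OF u] that by simp
  have bits: "rat_bits (rat_of_nat k) \<le> L + 4" if "k \<le> L + 1" for k
    using rat_bits_of_nat_le[of k] that by simp
  define time where "time = mset_cost E ?n (L + 1) u
           + (\<Sum>i<dim_vec u. op_cost E Sub
                [of_nat (u $ i), if i = 0 then 1 else of_nat (u $ (i - 1))])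
           + (\<Sum>i<dim_vec ?v. op_cost E Cmp [of_nat (?v $ i), 0])
           + (\<Sum>i<dim_vec ?b. op_cost E Assign [of_nat (?b $ i)])"
  have c1: "mset_cost E ?n (L + 1) u \<le> K * (1 + (L + 1))" by (rule mset_cost_le[OF u])
  have c2: "(\<Sum>i<dim_vec u. op_cost E Sub
      [of_nat (u $ i), if i = 0 then 1 else of_nat (u $ (i - 1))]) \<le> ?n * (K * W)"
    unfolding n
  proof (intro sum_le_card_mult small_op_cost)
    fix i assume i: "i < ?n"
    then have "i - 1 < ?n" by simp
    then show "(\<Sum>r\<leftarrow>[rat_of_nat (u $ i), if i = 0 then 1 else of_nat (u $ (i - 1))].
        rat_bits r) \<le> 2 * L + 8"
      using bits[OF u_le[OF i]] bits[OF u_le[of "i - 1"]] bits[of 1] by (cases "i = 0") simp_all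
  qed
  have c3: "(\<Sum>i<dim_vec ?v. op_cost E Cmp [of_nat (?v $ i), 0]) \<le> ?n * (K * W)"
    unfolding dim_phi n
  proof (intro sum_le_card_mult small_op_cost)
    fix i assume "i < ?n"
    then show "(\<Sum>r\<leftarrow>[rat_of_nat (?v $ i), 0]. rat_bits r) \<le> 2 * L + 8"
      using bits[of "?v $ i"] v_le[of i] bits[of 0] by simp
  qed
  have c4: "(\<Sum>i<dim_vec ?b. op_cost E Assign [of_nat (?b $ i)]) \<le> ?n * (K * W)"
  proof -
    have d: "dim_vec ?b = ?n" by (simp add: support_vec_def n)
    show ?thesis unfolding d
    proof (intro sum_le_card_mult small_op_cost)
      fix i assume "i < ?n"
      then show "(\<Sum>r\<leftarrow>[rat_of_nat (?b $ i)]. rat_bits r) \<le> 2 * L + 8"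
        using bits[of "?b $ i"] by (auto simp: support_vec_def n)
    qed
  qed
  have time: "time \<le> 4 * K * W * M"
  proof -
    have "1 + ?n \<le> M"
      using mult_le_mono[of "1 + ?n" "ip_dim P + ip_ncon P + 1" 1 "(B + 1)\<^sup>2"] by (simp add: M_def)
    then have "W * (1 + ?n) \<le> W * M" by (rule mult_le_mono2)
    moreover have "1 + (L + 1) \<le> W" by (simp add: W_def power2_eq_square algebra_simps)
    ultimately have "1 + (L + 1) + 3 * ?n * W \<le> 4 * (W * M)" by (simp add: algebra_simps)
    then have "K * (1 + (L + 1) + 3 * ?n * W) \<le> K * (4 * (W * M))" by (rule mult_le_mono2)
    moreover have "time \<le> K * (1 + (L + 1) + 3 * ?n * W)"
      using c1 c2 c3 c4 by (simp add: time_def algebra_simps)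
    ultimately show ?thesis by (simp add: ac_simps)
  qed
  have bin: "binary_vec ?b" by (simp add: binary_vec_def support_vec_def)
  then have ord: "distinct (sign_order E ?b)" "set (sign_order E ?b) = sign_perm ?b"
    using valid_orders by (auto simp: valid_orders_def)
  have "length (sign_order E ?b) = card (sign_perm ?b)"
    using distinct_card[OF ord(1)] ord(2) by simp
  also have "\<dots> \<le> 2 ^ L"
    using sum_phi_le[OF u] by (intro card_sign_perm_le) (simp add: n)
  finally have len: "length (sign_order E ?b) \<le> 2 ^ L" .
  have "(\<lambda>s S' t. invar s (S \<union> S') t) (fold (visit E P cf cg ?v ?b) (sign_order E ?b) (r, t0 + time))
      (\<Union>\<sigma>\<in>set (sign_order E ?b). {hadamard ?v \<sigma>})
      ((t + 4 * K * W * M) + length (sign_order E ?b) * ?V)"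
  proof (rule fold_invariant_time)
    show "invar (r, t0 + time) (S \<union> {}) (t + 4 * K * W * M)"
      using inv time by (simp add: invar_def s)
  next
    fix \<sigma> s' S' t'
    assume "\<sigma> \<in> set (sign_order E ?b)" and inv': "invar s' (S \<union> S') t'"
    then have \<sigma>: "\<sigma> \<in> sign_perm ?b" by (simp add: ord)
    have "hadamard ?v \<sigma> \<in> int_ball ?n L" using visited_points u \<sigma> by blast
    from visit_invar[OF inv' _ v_le \<sigma> this]
    show "invar (visit E P cf cg ?v ?b \<sigma> s') (S \<union> (S' \<union> {hadamard ?v \<sigma>})) (t' + ?V)"
      by (simp add: n Un_assoc)
  qed
  moreover have "process_mset E P cf cg (L + 1) u s =
      fold (visit E P cf cg ?v ?b) (sign_order E ?b) (r, t0 + time)"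
    unfolding process_mset_def s Let_def prod.case time_def ..
  moreover have "(\<Union>\<sigma>\<in>set (sign_order E ?b). {hadamard ?v \<sigma>}) = hadamard ?v ` sign_perm ?b"
    by (auto simp: ord)
  ultimately have "invar (process_mset E P cf cg (L + 1) u s) (S \<union> hadamard ?v ` sign_perm ?b)
      ((t + 4 * K * W * M) + length (sign_order E ?b) * ?V)" by simp
  moreover have "length (sign_order E ?b) * ?V \<le> 2 ^ L * ?V" using len by (rule mult_le_mono1)
  ultimately show ?thesis by (elim invar_mono) simp
qed

text \<open>
  At most \<open>(n + 1)\<^sup>L\<close> multisets with at most \<open>2\<^sup>L\<close> sign permutations each, and a visit takes \<open>T\<close> plus a
  multiple of \<open>M\<close>.
\<close>

theorem algorithm1_bounded_run:
  assumes "0 \<le> l" and L: "L = nat \<lfloor>l\<rfloor>" and "algorithm1 E P cf cg l = (result, time)"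
  shows "solves P l result" and "time \<le> run_factor K L * ((ip_dim P + 1) ^ L * (T + M))"
proof -
  let ?n = "ip_dim P" and ?A = "4 * K * W * M"
  let ?V = "?A + 2 ^ L * (T + ?A)" and ?us = "mset_order E ?n (L + 1)"
  have ord: "distinct ?us" "set ?us = msets ?n (L + 1)"
    using valid_orders by (auto simp: valid_orders_def)
  have len: "length ?us \<le> (?n + 1) ^ L"
    using distinct_card[OF ord(1)] card_msets_le[of ?n L] by (simp only: ord)
  have "invar (fold (process_mset E P cf cg (L + 1)) ?us ((None, None), op_cost E Assign []))
      (\<Union>u\<in>set ?us. hadamard (phi u) ` sign_perm (support_vec (phi u))) (K + length ?us * ?V)"
  proof (rule fold_invariant_time)
    show "invar ((None, None), op_cost E Assign []) {} K"
      using op_cost_le[of Assign "[]"] by (simp add: invar_def incumbent_for_def)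
  qed (rule process_mset_invar, assumption, simp only: ord)
  moreover have "fold (process_mset E P cf cg (L + 1)) ?us ((None, None), op_cost E Assign []) =
      (result, time)"
    using assms(3) by (simp add: algorithm1_def L Let_def)
  ultimately have inv: "invar (result, time) (int_ball ?n L) (K + length ?us * ?V)"
    using visited_points[of ?n L] by (simp only: ord)
  then show "solves P l result"
    unfolding solves_iff_incumbent_for[OF \<open>0 \<le> l\<close>] L[symmetric] invar_def by simp
  have time: "time \<le> K + length ?us * ?V" using inv by (simp add: invar_def)
  have "1 \<le> W" by (simp add: W_def)
  moreover have "M \<noteq> 0" by (simp add: M_def)
  then have "1 \<le> M" by simp
  ultimately have K: "K \<le> K * W * M" by (metis mult_le_mono mult.right_neutral le_refl)
  define p where "p = (2::nat) ^ L"
  have p: "1 \<le> p" by (simp add: p_def)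
  have "K + length ?us * ?V \<le> (?n + 1) ^ L * K + (?n + 1) ^ L * ?V"
    using len by (intro add_mono mult_le_mono1) simp_all
  also have "\<dots> = (?n + 1) ^ L * (K + ?V)" by (simp add: distrib_left)
  also have "K + ?V \<le> run_factor K L * (T + M)"
  proof -
    have "K + ?V \<le> 5 * (K * W * M) + p * (T + 4 * (K * W * M))"
      using K by (simp add: p_def ac_simps)
    also have "\<dots> \<le> p * (5 * (K * W * M)) + p * (T + 4 * (K * W * M))"
      using mult_le_mono1[OF p, of "5 * (K * W * M)"] by simp
    also have "\<dots> = p * (T + 9 * K * W * M)" by (simp add: algebra_simps)
    also have "\<dots> \<le> p * ((1 + 9 * K * W) * (T + M))"
      by (intro mult_le_mono2) (simp add: algebra_simps)
    also have "\<dots> = run_factor K L * (T + M)"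
      unfolding run_factor_def p_def W_def by (rule mult.assoc[symmetric])
    finally show ?thesis .
  qed
  finally have "K + length ?us * ?V \<le> (?n + 1) ^ L * (run_factor K L * (T + M))" by simp
  then show "time \<le> run_factor K L * ((?n + 1) ^ L * (T + M))"
    using time by (simp add: ac_simps)
qed

end

text \<open>
  With \<open>e \<ge> 1\<close> and values of fewer than \<open>q\<close> bits, also \<^term>\<open>M\<close> is at most \<open>3 q\<^sup>2 m n\<^sup>e\<close>, so all work done
  at a point fits into the evaluation bound; the enumeration contributes the remaining factor \<open>n\<^sup>L\<close>.
\<close>

lemma (in bounded_run) algorithm1_monomial_time:
  assumes "0 \<le> l" "L = nat \<lfloor>l\<rfloor>" "algorithm1 E P cf cg l = (result, time)"
    and n: "1 \<le> ip_dim P" and m: "1 \<le> ip_ncon P" and e: "1 \<le> e"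
    and T: "T \<le> a * (q\<^sup>2 * ip_ncon P * ip_dim P ^ e)" and B: "B + 1 \<le> q"
  shows "time \<le> run_factor K L * 2 ^ L * (a + 3) * (q\<^sup>2 * ip_ncon P * ip_dim P ^ (L + e))"
proof -
  let ?n = "ip_dim P" and ?m = "ip_ncon P"
  have "(?n + 1) ^ L \<le> (2 * ?n) ^ L" using n by (intro power_mono) auto
  then have pow: "(?n + 1) ^ L \<le> 2 ^ L * ?n ^ L" by (simp add: power_mult_distrib)
  have "?n \<le> ?m * ?n ^ e"
    using mult_le_mono[OF m power_increasing[OF e n]] by simp
  moreover have "?m \<le> ?m * ?n ^ e" "1 \<le> ?m * ?n ^ e" using n m by simp_all
  ultimately have "?n + ?m + 1 \<le> 3 * (?m * ?n ^ e)" by linarith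
  moreover have "(B + 1)\<^sup>2 \<le> q\<^sup>2" using B by (intro power_mono) auto
  ultimately have "M \<le> 3 * (?m * ?n ^ e) * q\<^sup>2" unfolding M_def by (rule mult_le_mono)
  then have "T + M \<le> (a + 3) * (q\<^sup>2 * ?m * ?n ^ e)"
    using T by (simp add: algebra_simps)
  with pow have "(?n + 1) ^ L * (T + M) \<le> (2 ^ L * ?n ^ L) * ((a + 3) * (q\<^sup>2 * ?m * ?n ^ e))"
    by (rule mult_le_mono)
  then have "run_factor K L * ((?n + 1) ^ L * (T + M)) \<le>
      run_factor K L * ((2 ^ L * ?n ^ L) * ((a + 3) * (q\<^sup>2 * ?m * ?n ^ e)))"
    by (rule mult_le_mono2)
  also have "\<dots> = run_factor K L * 2 ^ L * (a + 3) * (q\<^sup>2 * ?m * ?n ^ (L + e))"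
    by (simp only: power_add ac_simps)
  finally show ?thesis using algorithm1_bounded_run(2)[OF assms(1-3)] by linarith
qed

section \<open>Linear and quadratic programs\<close>

lemma vec_bits_ge: "v \<in> carrier_vec n \<Longrightarrow> 3 * n \<le> vec_bits v"
  using sum_mono[of "{..<n}" "\<lambda>_. 3" "\<lambda>i. rat_bits (v $ i)"] rat_bits_ge_3
  by (simp add: vec_bits_def)

lemma mat_bits_ge:
  assumes "A \<in> carrier_mat m n"
  shows "3 * (m * n) \<le> mat_bits A"
proof -
  have "(\<Sum>i<m. \<Sum>j<n. 3) \<le> (\<Sum>i<m. \<Sum>j<n. rat_bits (A $$ (i, j)))"
    by (intro sum_mono rat_bits_ge_3)
  then show ?thesis using assms by (simp add: mat_bits_def)
qed

lemma mat_bits_transpose: "mat_bits (transpose_mat A) = mat_bits A"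
proof -
  have "mat_bits (transpose_mat A) = (\<Sum>i<dim_col A. \<Sum>j<dim_row A. rat_bits (A $$ (j, i)))"
    by (auto simp: mat_bits_def intro!: sum.cong)
  also have "\<dots> = mat_bits A" unfolding mat_bits_def by (rule sum.swap)
  finally show ?thesis .
qed

lemma ilp_bits_ge:
  shows "vec_bits c \<le> ilp_bits A b c"
    and "i < dim_row A \<Longrightarrow> vec_bits (row A i) + rat_bits (b $ i) \<le> ilp_bits A b c"
  unfolding ilp_bits_def by (intro Max_ge; simp)+

lemma iqp_bits_ge:
  shows "mat_bits Q + vec_bits c \<le> iqp_bits m Q c A b d"
    and "i < m \<Longrightarrow> mat_bits (A i) + vec_bits (b i) + rat_bits (d $ i) \<le> iqp_bits m Q c A b d"
  unfolding iqp_bits_def by (intro Max_ge; simp)+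

text \<open>
  Since every rational takes at least three bits, the data of an \<open>n\<close>-dimensional program have size
  \<open>s \<ge> 3n\<close>; hence the points are no longer than the data, up to a constant depending on \<open>L\<close>.
\<close>

lemma small_point_bits:
  assumes "x \<in> int_ball n L" "1 \<le> n" "3 * n \<le> s"
  shows "vec_bits (rat_vec x) \<le> (L + 1) * s"
proof -
  have "L * 1 \<le> L * s" using assms by (intro mult_le_mono2) linarith
  moreover have "(L + 1) * s = L * s + s" by simp
  ultimately show ?thesis using vec_bits_int_ball[OF assms(1)] assms(3) by linarith
qed

context exec_costs
begin

text \<open>
  The factor \<open>2L + 10\<close> is chosen so that \<open>q = (2L + 10) s\<close> exceeds the operand sizes of every dot
  product and of every subtraction of a right-hand side.
\<close>

lemma bounded_run_ilp:
  assumes n: "1 \<le> n" and m: "1 \<le> m"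
    and A: "A \<in> carrier_mat m n" and b: "b \<in> carrier_vec m" and c: "c \<in> carrier_vec n"
  defines "s \<equiv> ilp_bits A b c"
  shows "bounded_run E K (ilp A b c) (ilp_obj_cost E c) (ilp_con_cost E A b) L
    (3 * K * (((2 * L + 10) * s)\<^sup>2 * m * n ^ 1)) (2 * ((L + 2) * s) + 4)"
proof -
  let ?B = "2 * ((L + 2) * s) + 4" and ?q = "(2 * L + 10) * s"
  have c_le: "vec_bits c \<le> s" unfolding s_def by (rule ilp_bits_ge)
  have row_le: "vec_bits (row A i) + rat_bits (b $ i) \<le> s" if "i < m" for i
    unfolding s_def using A that by (intro ilp_bits_ge) auto
  have s: "3 * n \<le> s" using vec_bits_ge[OF c] c_le by simp
  have x_le: "vec_bits (rat_vec x) \<le> (L + 1) * s" if "x \<in> int_ball n L" for x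
    by (rule small_point_bits[OF that n s])
  have x_dim: "rat_vec x \<in> carrier_vec n" if "x \<in> int_ball n L" for x
    using that by (auto simp: int_ball_def)
  have dim: "ip_dim (ilp A b c) = n" "ip_ncon (ilp A b c) = m" using A by (auto simp: ilp_def)
  have bits: "rat_bits r \<le> ?B" if "fits r k" "k \<le> (L + 2) * s" for r k
    using rat_bits_le_fits[OF that(1)] that(2) by linarith
  have q: "(L + 1) * s \<le> ?q" "1 + (?B + s) \<le> ?q"
    using s n by (simp_all add: algebra_simps)
  have dot: "dot_cost E a (rat_vec x) \<le> K * ?q\<^sup>2 * n"
    if "a \<in> carrier_vec n" "vec_bits a \<le> s" "x \<in> int_ball n L" for a x
    using that x_le[OF that(3)] q(1) x_dim[OF that(3)] by (intro dot_cost_le) auto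
  show ?thesis
  proof (unfold_locales, unfold dim)
    fix x assume x: "x \<in> int_ball n L"
    show "ip_con (ilp A b c) x \<in> carrier_vec m" using b by (intro carrier_vecI) (simp add: ilp_def)
    have "fits (c \<bullet> rat_vec x) (vec_bits c + vec_bits (rat_vec x))"
      using c x_dim[OF x] by (intro fits_scalar_prod) auto
    then show "rat_bits (ip_obj (ilp A b c) x) \<le> ?B"
      unfolding ilp_def int_prog.simps by (rule bits) (use c_le x_le[OF x] in simp)
    have prod: "fits (row A i \<bullet> rat_vec x) (vec_bits (row A i) + vec_bits (rat_vec x))"
      if "i < m" for i
      using A x_dim[OF x] that by (intro fits_scalar_prod) auto
    show "rat_bits (ip_con (ilp A b c) x $ i) \<le> ?B" if i: "i < m" for i
    proof -
      have "ip_con (ilp A b c) x $ i = row A i \<bullet> rat_vec x - b $ i"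
        using A b i by (simp add: ilp_def)
      then show ?thesis
        using bits[OF fits_diff[OF prod[OF i] fits_rat_bits]] row_le[OF i] x_le[OF x] by simp
    qed
    have "ilp_obj_cost E c x \<le> K * ?q\<^sup>2 * n"
      unfolding ilp_obj_cost_def using c c_le x by (intro dot)
    moreover have "ilp_con_cost E A b x \<le> m * (2 * (K * ?q\<^sup>2 * n))"
    proof -
      have "dot_cost E (row A i) (rat_vec x) + op_cost E Sub [row A i \<bullet> rat_vec x, b $ i]
          \<le> 2 * (K * ?q\<^sup>2 * n)" if i: "i < m" for i
      proof -
        have "rat_bits (row A i \<bullet> rat_vec x) \<le> ?B"
          by (rule bits[OF prod[OF i]]) (use row_le[OF i] x_le[OF x] in simp)
        then have "op_cost E Sub [row A i \<bullet> rat_vec x, b $ i] \<le> K * (1 + (?B + s))\<^sup>2"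
          using row_le[OF i] by (intro op_cost_le_bits) simp
        also have "\<dots> \<le> K * ?q\<^sup>2" using q(2) by (intro mult_le_mono2 power_mono) auto
        also have "\<dots> \<le> K * ?q\<^sup>2 * n" using n by simp
        finally have "op_cost E Sub [row A i \<bullet> rat_vec x, b $ i] \<le> K * ?q\<^sup>2 * n" .
        moreover have "dot_cost E (row A i) (rat_vec x) \<le> K * ?q\<^sup>2 * n"
          using A row_le[OF i] x by (intro dot) auto
        ultimately show ?thesis by linarith
      qed
      then show ?thesis unfolding ilp_con_cost_def using A by (simp add: sum_le_card_mult)
    qed
    moreover have "K * ?q\<^sup>2 * n \<le> m * (K * ?q\<^sup>2 * n)" using m by simp
    ultimately have "ilp_obj_cost E c x + ilp_con_cost E A b x \<le> 3 * (m * (K * ?q\<^sup>2 * n))"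
      by linarith
    also have "\<dots> = 3 * K * (?q\<^sup>2 * m * n ^ 1)" by (simp only: power_one_right ac_simps)
    finally show "ilp_obj_cost E c x + ilp_con_cost E A b x \<le> 3 * K * (?q\<^sup>2 * m * n ^ 1)" .
  qed
qed

text \<open>
  A quadratic form reads the point \<open>n + 1\<close> times, which could cost \<open>n \<cdot> vec_bits x\<close>, of order \<open>n\<^sup>2\<close>, extra bits; this is
  still \<open>O(s)\<close>, because the matrix itself has \<open>n\<^sup>2\<close> entries and so \<open>3n\<^sup>2 \<le> s\<close>. Again \<open>q = (4L + 25) s\<close>
  exceeds the operand sizes of all operations.
\<close>

lemma bounded_run_iqp:
  fixes d :: "rat vec"
  assumes n: "1 \<le> n" and m: "1 \<le> m"
    and Q: "Q \<in> carrier_mat n n" and c: "c \<in> carrier_vec n"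
    and Ab: "\<forall>i<m. A i \<in> carrier_mat n n \<and> b i \<in> carrier_vec n"
  defines "s \<equiv> iqp_bits m Q c A b d"
  shows "bounded_run E K (iqp n m Q c A b d) (iqp_obj_cost E Q c) (iqp_con_cost E m A b d) L
    (7 * K * (((4 * L + 25) * s)\<^sup>2 * m * n ^ 2)) (2 * ((L + 4) * s) + 4)"
proof -
  let ?B = "2 * ((L + 4) * s) + 4" and ?q = "(4 * L + 25) * s"
  have obj_le: "mat_bits Q + vec_bits c \<le> s" unfolding s_def by (rule iqp_bits_ge)
  have con_le: "mat_bits (A i) + vec_bits (b i) + rat_bits (d $ i) \<le> s" if "i < m" for i
    unfolding s_def using that by (rule iqp_bits_ge)
  have s2: "3 * (n * n) \<le> s" using mat_bits_ge[OF Q] obj_le by simp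
  then have s: "3 * n \<le> s" using n by (meson le_square le_trans mult_le_mono2)
  have x_le: "vec_bits (rat_vec x) \<le> (L + 1) * s" if "x \<in> int_ball n L" for x
    by (rule small_point_bits[OF that n s])
  have x_le2: "(n + 2) * vec_bits (rat_vec x) \<le> (L + 3) * s" if "x \<in> int_ball n L" for x
  proof -
    have "L * 1 \<le> L * n" using n by (rule mult_le_mono2)
    moreover have "(L + 3) * n = L * n + 3 * n" by (rule add_mult_distrib)
    ultimately have "vec_bits (rat_vec x) \<le> (L + 3) * n"
      using vec_bits_int_ball[OF that] by linarith
    moreover have "n + 2 \<le> 3 * n" using n by simp
    ultimately have "(n + 2) * vec_bits (rat_vec x) \<le> (3 * n) * ((L + 3) * n)"
      by (intro mult_le_mono)
    also have "\<dots> = (L + 3) * (3 * (n * n))" by (simp only: ac_simps)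
    also have "\<dots> \<le> (L + 3) * s" using s2 by (rule mult_le_mono2)
    finally show ?thesis .
  qed
  have x_dim: "rat_vec x \<in> carrier_vec n" if "x \<in> int_ball n L" for x
    using that by (auto simp: int_ball_def)
  have dim: "ip_dim (iqp n m Q c A b d) = n" "ip_ncon (iqp n m Q c A b d) = m"
    by (auto simp: iqp_def)
  have bits: "rat_bits r \<le> ?B" if "fits r k" "k \<le> (L + 4) * s" for r k
    using rat_bits_le_fits[OF that(1)] that(2) by linarith
  have q: "(L + 1) * s \<le> ?q" "1 + 2 * ?B \<le> ?q" "s \<le> ?B" "?B + 1 \<le> ?q"
    using s n by (simp_all add: algebra_simps)
  have x_q: "vec_bits (rat_vec x) \<le> ?q" if "x \<in> int_ball n L" for x
    using x_le[OF that] q(1) by linarith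
  have s_q: "s \<le> ?q" by simp
  let ?Z = "K * ?q\<^sup>2 * n\<^sup>2"
  have quad: "quad_cost E R (rat_vec x) \<le> ?Z"
    if "R \<in> carrier_mat n n" "mat_bits R \<le> s" "x \<in> int_ball n L" for R x
    using that x_q[OF that(3)] s_q x_dim[OF that(3)] by (intro quad_cost_le) (assumption | linarith)+
  have dot: "dot_cost E a (rat_vec x) \<le> ?Z"
    if "a \<in> carrier_vec n" "vec_bits a \<le> s" "x \<in> int_ball n L" for a x
  proof -
    have "dot_cost E a (rat_vec x) \<le> K * ?q\<^sup>2 * n"
      using that x_q[OF that(3)] s_q x_dim[OF that(3)] by (intro dot_cost_le) (assumption | linarith)+
    also have "\<dots> \<le> ?Z" by (rule mult_le_mono2) (simp add: power2_eq_square)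
    finally show ?thesis .
  qed
  have op: "op_cost E Add [y, z] \<le> ?Z" if "rat_bits y \<le> ?B" "rat_bits z \<le> ?B" for y z
  proof -
    have "op_cost E Add [y, z] \<le> K * (1 + 2 * ?B)\<^sup>2"
      using that by (intro op_cost_le_bits) simp
    also have "\<dots> \<le> K * ?q\<^sup>2" using q(2) by (intro mult_le_mono2 power_mono) auto
    also have "\<dots> \<le> ?Z" using n by simp
    finally show ?thesis .
  qed
  show ?thesis
  proof (unfold_locales, unfold dim)
    fix x assume x: "x \<in> int_ball n L"
    have qf: "fits (quad_form R (rat_vec x)) (mat_bits R + (n + 1) * vec_bits (rat_vec x))"
      if "R \<in> carrier_mat n n" for R
      using that x_dim[OF x] by (rule fits_quad_form)
    have sp: "fits (a \<bullet> rat_vec x) (vec_bits a + vec_bits (rat_vec x))"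
      if "a \<in> carrier_vec n" for a
      using that x_dim[OF x] by (intro fits_scalar_prod) auto
    show "ip_con (iqp n m Q c A b d) x \<in> carrier_vec m" by (simp add: iqp_def)
    show "rat_bits (ip_obj (iqp n m Q c A b d) x) \<le> ?B"
      unfolding iqp_def int_prog.simps
      by (rule bits[OF fits_add[OF qf[OF Q] sp[OF c]]])
        (use obj_le x_le2[OF x] in \<open>simp add: algebra_simps\<close>)
    have Ai: "A i \<in> carrier_mat n n" and bi: "b i \<in> carrier_vec n" if "i < m" for i
      using Ab that by auto
    show "rat_bits (ip_con (iqp n m Q c A b d) x $ i) \<le> ?B" if i: "i < m" for i
    proof -
      have "ip_con (iqp n m Q c A b d) x $ i =
          quad_form (A i) (rat_vec x) + b i \<bullet> rat_vec x + d $ i"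
        using i by (simp add: iqp_def)
      moreover have "rat_bits \<dots> \<le> ?B"
        by (rule bits[OF fits_add[OF fits_add[OF qf[OF Ai[OF i]] sp[OF bi[OF i]]] fits_rat_bits]])
          (use con_le[OF i] x_le2[OF x] in \<open>simp add: algebra_simps\<close>)
      ultimately show ?thesis by simp
    qed
    have qfB: "rat_bits (quad_form R (rat_vec x)) \<le> ?B"
      if "R \<in> carrier_mat n n" "mat_bits R \<le> s" for R
      by (rule bits[OF qf[OF that(1)]]) (use that(2) x_le2[OF x] in \<open>simp add: algebra_simps\<close>)
    have spB: "rat_bits (a \<bullet> rat_vec x) \<le> ?B"
      if "a \<in> carrier_vec n" "vec_bits a \<le> s" for a
      by (rule bits[OF sp[OF that(1)]]) (use that(2) x_le[OF x] in \<open>simp add: algebra_simps\<close>)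
    have "iqp_obj_cost E Q c x \<le> 3 * ?Z"
    proof -
      have le: "mat_bits Q \<le> s" "vec_bits c \<le> s" using obj_le by simp_all
      show ?thesis
        using quad[OF Q le(1) x] dot[OF c le(2) x] op[OF qfB[OF Q le(1)] spB[OF c le(2)]]
        unfolding iqp_obj_cost_def by linarith
    qed
    moreover have "iqp_con_cost E m A b d x \<le> m * (4 * ?Z)"
      unfolding iqp_con_cost_def
    proof (rule sum_le_card_mult)
      fix i assume i: "i < m"
      have le: "mat_bits (A i) \<le> s" "vec_bits (b i) \<le> s" "rat_bits (d $ i) \<le> ?B"
        using con_le[OF i] q(3) by linarith+
      have sum: "rat_bits (quad_form (A i) (rat_vec x) + b i \<bullet> rat_vec x) \<le> ?B"
        by (rule bits[OF fits_add[OF qf[OF Ai[OF i]] sp[OF bi[OF i]]]])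
          (use con_le[OF i] x_le2[OF x] in \<open>simp add: algebra_simps\<close>)
      show "quad_cost E (A i) (rat_vec x) + dot_cost E (b i) (rat_vec x)
          + op_cost E Add [quad_form (A i) (rat_vec x), b i \<bullet> rat_vec x]
          + op_cost E Add [quad_form (A i) (rat_vec x) + b i \<bullet> rat_vec x, d $ i] \<le> 4 * ?Z"
        using quad[OF Ai[OF i] le(1) x] dot[OF bi[OF i] le(2) x]
          op[OF qfB[OF Ai[OF i] le(1)] spB[OF bi[OF i] le(2)]] op[OF sum le(3)] by linarith
    qed
    moreover have "?Z \<le> m * ?Z" using m by simp
    ultimately have "iqp_obj_cost E Q c x + iqp_con_cost E m A b d x \<le> 7 * (m * ?Z)"
      by linarith
    also have "\<dots> = 7 * K * (?q\<^sup>2 * m * n ^ 2)" by (simp only: ac_simps)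
    finally show "iqp_obj_cost E Q c x + iqp_con_cost E m A b d x \<le> 7 * K * (?q\<^sup>2 * m * n ^ 2)" .
  qed
qed

end

text \<open>
  The exponent \<open>((2 + \<delta>) L)\<^sup>2 / 2\<close> is at least \<open>2 L\<^sup>2\<close>, which is at least \<open>L\<close> because \<open>L\<close> is a natural
  number.
\<close>

lemma real_time_le_powr:
  assumes "0 \<le> l" "L = nat \<lfloor>l\<rfloor>" "0 < \<delta>" "1 \<le> n"
    and time: "time \<le> C * (k * s)\<^sup>2 * m * n ^ (L + e)"
  shows "real time \<le> real (C * k\<^sup>2) *
    ((real s)\<^sup>2 * real m * real n powr (((2 + \<delta>) * real_of_int \<lfloor>l\<rfloor>)\<^sup>2 / 2 + real e))"
proof -
  have L: "real_of_int \<lfloor>l\<rfloor> = real L" using assms by simp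
  have "real L \<le> (real L)\<^sup>2" using le_square[of L] by (simp add: power2_eq_square flip: of_nat_mult)
  moreover have "(2 * real L)\<^sup>2 \<le> ((2 + \<delta>) * real L)\<^sup>2"
    using assms(3) by (intro power_mono mult_right_mono) auto
  moreover have "(2 * real L)\<^sup>2 = 4 * (real L)\<^sup>2" by (simp add: power_mult_distrib)
  ultimately have "real L \<le> ((2 + \<delta>) * real L)\<^sup>2 / 2" by linarith
  then have "real n powr (real L + real e) \<le> real n powr (((2 + \<delta>) * real L)\<^sup>2 / 2 + real e)"
    using assms(4) by (intro powr_mono) auto
  moreover have "real n ^ (L + e) = real n powr (real L + real e)"
    using assms(4) by (simp add: powr_realpow flip: of_nat_add)
  ultimately have pow: "real n ^ (L + e) \<le> real n powr (((2 + \<delta>) * real L)\<^sup>2 / 2 + real e)" by simp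
  have "real time \<le> real (C * (k * s)\<^sup>2 * m * n ^ (L + e))" using time by (rule of_nat_mono)
  also have "\<dots> = real (C * k\<^sup>2) * ((real s)\<^sup>2 * real m * real n ^ (L + e))"
    by (simp add: power_mult_distrib)
  also have "\<dots> \<le> real (C * k\<^sup>2) * ((real s)\<^sup>2 * real m *
      real n powr (((2 + \<delta>) * real L)\<^sup>2 / 2 + real e))"
    using pow by (intro mult_left_mono) auto
  finally show ?thesis by (simp only: L)
qed

section \<open>Polynomial-time computable programs\<close>

lemma poly_nat_mono: "x \<le> y \<Longrightarrow> poly p x \<le> poly p (y :: nat)"
  by (induction p) (auto intro!: add_mono mult_mono)

lemma tm_run_Suc: "tm_run M w (Suc t) = tm_step M (tm_run M w t)"
  by (simp add: tm_run_def)

text \<open>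
  Each step writes a single cell. This is what turns a bound on running time into one on output size.
\<close>

lemma tape_support:
  "finite {i. fst (snd (tm_run M w t)) i \<noteq> 0} \<and>
   card {i. fst (snd (tm_run M w t)) i \<noteq> 0} \<le> length w + t"
proof (induction t)
  case 0
  have sub: "{i. fst (snd (tm_run M w 0)) i \<noteq> 0} \<subseteq> int ` {..<length w}"
  proof
    fix i assume "i \<in> {i. fst (snd (tm_run M w 0)) i \<noteq> 0}"
    then have "0 \<le> i" "i < int (length w)"
      by (auto simp: tm_run_def tm_init_def split: if_splits)
    then show "i \<in> int ` {..<length w}" by (intro image_eqI[of _ _ "nat i"]) auto
  qed
  then show ?case
    using card_mono[OF _ sub] card_image_le[of "{..<length w}" int] by (auto intro: finite_subset)
next
  case (Suc t)
  obtain q tape h where c: "tm_run M w t = (q, tape, h)" by (metis surj_pair)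
  have sub: "{i. fst (snd (tm_run M w (Suc t))) i \<noteq> 0} \<subseteq> insert h {i. tape i \<noteq> 0}"
    by (auto simp: tm_run_Suc c tm_step_def split: prod.splits if_splits)
  have fin: "finite {i. tape i \<noteq> 0}" and card: "card {i. tape i \<noteq> 0} \<le> length w + t"
    using Suc by (simp_all add: c)
  have "card (insert h {i. tape i \<noteq> 0}) \<le> Suc (card {i. tape i \<noteq> 0})"
    by (rule card_insert_le_m1[THEN le_trans]) auto
  then show ?case
    using card_mono[OF _ sub] fin card finite_subset[OF sub] by simp
qed

text \<open>
  Without blanks inside the output, all its cells count as nonblank cells of the tape.
\<close>

lemma tm_computes_output_length:
  assumes "tm_computes M w out t" "0 \<notin> set out"
  shows "length out \<le> length w + t"
proof -
  let ?S = "{i. fst (snd (tm_run M w t)) i \<noteq> 0}"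
  have S: "finite ?S" "card ?S \<le> length w + t" using tape_support[of M w t] by simp_all
  have "int ` {..<length out} \<subseteq> ?S"
  proof (rule image_subsetI)
    fix i assume "i \<in> {..<length out}"
    then have "fst (snd (tm_run M w t)) (int i) = out ! i" "out ! i \<in> set out"
      using assms(1) by (auto simp: tm_computes_def split: prod.splits)
    then have "fst (snd (tm_run M w t)) (int i) \<noteq> 0" using assms(2) by metis
    then show "int i \<in> ?S" by blast
  qed
  from card_mono[OF S(1) this] S(2) show ?thesis by (simp add: card_image)
qed

lemma tm_computes_time: "tm_computes M w out t \<Longrightarrow> tm_time M w \<le> t"
  unfolding tm_time_def by (rule Least_le) (auto simp: tm_computes_def split: prod.splits)

lemma length_int_word: "length (int_word z) = int_bits z + 1"
  by (simp add: int_word_def bits_word_def int_bits_def)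

lemma length_rat_word: "length (rat_word r) = rat_bits r + 2"
  by (simp add: rat_word_def rat_bits_def length_int_word split: prod.splits)

lemma length_vec_word: "length (vec_word code v) = (\<Sum>i<dim_vec v. length (code (v $ i)))"
  by (simp add: vec_word_def length_concat sum_list_sum_nth list_of_vec_index atLeast0LessThan)

lemma nonblank_rat_word: "0 \<notin> set (rat_word r)"
  by (auto simp: rat_word_def int_word_def bits_word_def split: prod.splits)

lemma nonblank_vec_word: "0 \<notin> set (vec_word rat_word v)"
  using nonblank_rat_word by (auto simp: vec_word_def)

lemma length_eval_input: "length (eval_input w x) \<le> length w + 1 + vec_bits (rat_vec x)"
proof -
  have "(\<Sum>i<dim_vec x. length (int_word (x $ i))) \<le> (\<Sum>i<dim_vec x. rat_bits (of_int (x $ i)))"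
    by (intro sum_mono) (simp add: length_int_word rat_bits_of_int)
  then show ?thesis
    by (simp add: eval_input_def length_vec_word bits_word_def vec_bits_def)
qed

text \<open>
  On the ball, the size of a point is linear in the dimension, so the size of the machine's input
  is linear in the parameter \<open>N = n + m + length w\<close>: \<open>n + m + length w + vec_bits x \<le> 4 N + L\<close>. Both
  running time and output length are then polynomial in \<open>N\<close>.
\<close>

lemma tm_eval_cost_poly:
  assumes ev: "evaluates_in_poly_time F I P h code" and nonblank: "\<And>r. 0 \<notin> set (code r)"
  obtains q :: "nat poly" where
    "\<And>w x. w \<in> I \<Longrightarrow> x \<in> int_ball (ip_dim (P w)) L \<Longrightarrow>
       tm_eval_cost F code (h w) w x \<le> poly q (ip_dim (P w) + ip_ncon (P w) + length w)"
proof -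
  obtain p :: "nat poly" where p: "\<forall>w\<in>I. \<forall>x\<in>carrier_vec (ip_dim (P w)).
      \<exists>t \<le> poly p (ip_dim (P w) + ip_ncon (P w) + length w + vec_bits (rat_vec x)).
        tm_computes F (eval_input w x) (code (h w x)) t"
    using ev unfolding evaluates_in_poly_time_def by blast
  (* The input has at most 4 N + L + 1 symbols and the run at most poly p (4 N + L) steps. Both count
     twice, since the output is bounded by their sum. *)
  let ?q = "[:2 * (L + 1), 8:] + Polynomial.smult 2 (pcompose p [:L, 4:])"
  show thesis
  proof (rule that[of ?q])
    fix w x assume w: "w \<in> I" and x: "x \<in> int_ball (ip_dim (P w)) L"
    let ?N = "ip_dim (P w) + ip_ncon (P w) + length w"
    have xb: "vec_bits (rat_vec x) \<le> 3 * ip_dim (P w) + L" by (rule vec_bits_int_ball[OF x])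
    obtain t where t: "t \<le> poly p (?N + vec_bits (rat_vec x))"
      "tm_computes F (eval_input w x) (code (h w x)) t"
      using p w x by (auto simp: int_ball_def)
    have "?N + vec_bits (rat_vec x) \<le> L + ?N * 4" using xb by simp
    with t(1) have "t \<le> poly p (L + ?N * 4)" by (meson poly_nat_mono le_trans)
    moreover have "length (eval_input w x) \<le> 4 * ?N + L + 1"
      using length_eval_input[of w x] xb by simp
    ultimately show "tm_eval_cost F code (h w) w x \<le> poly ?q ?N"
      using tm_computes_time[OF t(2)] tm_computes_output_length[OF t(2) nonblank]
      by (simp add: tm_eval_cost_def poly_pcompose algebra_simps)
  qed
qed

theorem corollary2:
  fixes l :: real and E :: exec_model
  assumes "0 \<le> l" and "valid_orders E" and "cost_conventions E"
  shows
    "(\<forall>(I :: bool list set) (P :: bool list \<Rightarrow> int_prog) F G.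
        (\<forall>w\<in>I. \<forall>x\<in>carrier_vec (ip_dim (P w)). ip_con (P w) x \<in> carrier_vec (ip_ncon (P w))) \<longrightarrow>
        evaluates_in_poly_time F I P (\<lambda>w. ip_obj (P w)) rat_word \<longrightarrow>
        evaluates_in_poly_time G I P (\<lambda>w. ip_con (P w)) (vec_word rat_word) \<longrightarrow>
        (\<exists>p :: nat poly. \<forall>w\<in>I.
          case algorithm1 E (P w)
            (tm_eval_cost F rat_word (ip_obj (P w)) w)
            (tm_eval_cost G (vec_word rat_word) (ip_con (P w)) w) l
          of (result, time) \<Rightarrow>
            solves (P w) l result \<and>
            time \<le> poly p (ip_dim (P w) + ip_ncon (P w) + length w)))
   \<and> (\<forall>\<delta>::real. 0 < \<delta> \<and> \<delta> < 1 \<longrightarrow>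
        (\<exists>C::real. \<forall>n m A b c. 1 \<le> n \<longrightarrow> 1 \<le> m \<longrightarrow>
          A \<in> carrier_mat m n \<longrightarrow> b \<in> carrier_vec m \<longrightarrow> c \<in> carrier_vec n \<longrightarrow>
          (case algorithm1 E (ilp A b c) (ilp_obj_cost E c) (ilp_con_cost E A b) l
           of (result, time) \<Rightarrow>
             solves (ilp A b c) l result \<and>
             real time \<le> C * ((real (ilp_bits A b c))\<^sup>2 * real m *
               real n powr (((2 + \<delta>) * real_of_int \<lfloor>l\<rfloor>)\<^sup>2 / 2 + 1)))))
   \<and> (\<forall>\<delta>::real. 0 < \<delta> \<and> \<delta> < 1 \<longrightarrow>
        (\<exists>C::real. \<forall>n m Q c A b d. 1 \<le> n \<longrightarrow> 1 \<le> m \<longrightarrow>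
          Q \<in> carrier_mat n n \<longrightarrow> c \<in> carrier_vec n \<longrightarrow>
          (\<forall>i<m. A i \<in> carrier_mat n n \<and> b i \<in> carrier_vec n) \<longrightarrow> d \<in> carrier_vec m \<longrightarrow>
          (case algorithm1 E (iqp n m (transpose_mat Q) c A b d)
             (iqp_obj_cost E (transpose_mat Q) c) (iqp_con_cost E m A b d) l
           of (result, time) \<Rightarrow>
             solves (iqp n m (transpose_mat Q) c A b d) l result \<and>
             real time \<le> C * ((real (iqp_bits m Q c A b d))\<^sup>2 * real m *
               real n powr (((2 + \<delta>) * real_of_int \<lfloor>l\<rfloor>)\<^sup>2 / 2 + 2)))))
   \<and> (\<forall>\<delta>::real. 0 < \<delta> \<and> \<delta> < 1 \<longrightarrow>
        (\<exists>C::real. \<forall>n m Q c A b d. 1 \<le> n \<longrightarrow> 1 \<le> m \<longrightarrow>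
          Q \<in> carrier_mat n n \<longrightarrow> c \<in> carrier_vec n \<longrightarrow>
          (\<forall>i<m. A i \<in> carrier_mat n n \<and> b i \<in> carrier_vec n) \<longrightarrow> d \<in> carrier_vec m \<longrightarrow>
          (case algorithm1 E (iqp n m Q c A b d)
             (iqp_obj_cost E Q c) (iqp_con_cost E m A b d) l
           of (result, time) \<Rightarrow>
             solves (iqp n m Q c A b d) l result \<and>
             real time \<le> C * ((real (iqp_bits m Q c A b d))\<^sup>2 * real m *
               real n powr (((2 + \<delta>) * real_of_int \<lfloor>l\<rfloor>)\<^sup>2 / 2 + 2)))))"
proof -
  obtain K where "exec_costs E K" using assms(2,3) by (rule exec_costs_ex)
  then interpret exec_costs E K .
  define L where "L = nat \<lfloor>l\<rfloor>"
  let ?D = "run_factor K L * 2 ^ L * (7 * K + 3)"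
  have iqp_bound: "solves (iqp n m Q c A b d) l result \<and>
      real time \<le> real (?D * (4 * L + 25)\<^sup>2) * ((real (iqp_bits m Q c A b d))\<^sup>2 * real m *
        real n powr (((2 + \<delta>) * real_of_int \<lfloor>l\<rfloor>)\<^sup>2 / 2 + 2))"
    if n: "1 \<le> n" and m: "1 \<le> m" and Q: "Q \<in> carrier_mat n n" and c: "c \<in> carrier_vec n"
      and Ab: "\<forall>i<m. A i \<in> carrier_mat n n \<and> b i \<in> carrier_vec n"
      and run: "algorithm1 E (iqp n m Q c A b d)
        (iqp_obj_cost E Q c) (iqp_con_cost E m A b d) l = (result, time)" and \<delta>: "0 < \<delta>"
    for n m Q c A b d result time and \<delta> :: real
  proof -
    let ?s = "iqp_bits m Q c A b d"
    interpret bounded_run E K "iqp n m Q c A b d" "iqp_obj_cost E Q c" "iqp_con_cost E m A b d" L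
      "7 * K * (((4 * L + 25) * ?s)\<^sup>2 * m * n ^ 2)" "2 * ((L + 4) * ?s) + 4"
      by (rule bounded_run_iqp[OF n m Q c Ab])
    have dim: "ip_dim (iqp n m Q c A b d) = n" "ip_ncon (iqp n m Q c A b d) = m"
      by (auto simp: iqp_def)
    have "1 \<le> ?s" using vec_bits_ge[OF c] iqp_bits_ge(1)[of Q c m A b d] n by linarith
    then have q: "2 * ((L + 4) * ?s) + 4 + 1 \<le> (4 * L + 25) * ?s"
      by (simp add: algebra_simps)
    have "time \<le> ?D * (((4 * L + 25) * ?s)\<^sup>2 * m * n ^ (L + 2))"
      using algorithm1_monomial_time[OF assms(1) L_def run, of 2 "7 * K" "(4 * L + 25) * ?s"] n m q
      by (simp only: dim)
    then have "time \<le> ?D * ((4 * L + 25) * ?s)\<^sup>2 * m * n ^ (L + 2)" by (simp only: mult.assoc)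
    from real_time_le_powr[OF assms(1) L_def \<delta> n this]
    show ?thesis using algorithm1_bounded_run(1)[OF assms(1) L_def run] by simp
  qed
  show ?thesis
  proof (intro conjI allI impI, goal_cases)
    case (1 I P F G)
    obtain qF :: "nat poly" where qF: "\<And>w x. w \<in> I \<Longrightarrow> x \<in> int_ball (ip_dim (P w)) L \<Longrightarrow>
        tm_eval_cost F rat_word (ip_obj (P w)) w x \<le> poly qF (ip_dim (P w) + ip_ncon (P w) + length w)"
      by (rule tm_eval_cost_poly[OF 1(2) nonblank_rat_word, of L]) blast
    obtain qG :: "nat poly" where qG: "\<And>w x. w \<in> I \<Longrightarrow> x \<in> int_ball (ip_dim (P w)) L \<Longrightarrow>
        tm_eval_cost G (vec_word rat_word) (ip_con (P w)) w x
          \<le> poly qG (ip_dim (P w) + ip_ncon (P w) + length w)"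
      by (rule tm_eval_cost_poly[OF 1(3) nonblank_vec_word, of L]) blast
    define q where "q = qF + qG"
    (* the general time bound with n and n + m enlarged to the argument N of the polynomials *)
    define p where "p = Polynomial.smult (run_factor K L) ([:1, 1:] ^ L * (q + [:1, 1:] * (q + 1)\<^sup>2))"
    show ?case
    proof (intro exI[of _ p] ballI, clarify)
      fix w result time
      let ?cF = "tm_eval_cost F rat_word (ip_obj (P w)) w"
        and ?cG = "tm_eval_cost G (vec_word rat_word) (ip_con (P w)) w"
        and ?N = "ip_dim (P w) + ip_ncon (P w) + length w"
      assume w: "w \<in> I" and run: "algorithm1 E (P w) ?cF ?cG l = (result, time)"
      have dim: "ip_con (P w) x \<in> carrier_vec (ip_ncon (P w))" if "x \<in> int_ball (ip_dim (P w)) L" for x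
        using 1(1) w that by (auto simp: int_ball_def)
      interpret bounded_run E K "P w" ?cF ?cG L "poly q ?N" "poly q ?N"
      proof
        fix x assume x: "x \<in> int_ball (ip_dim (P w)) L"
        show "ip_con (P w) x \<in> carrier_vec (ip_ncon (P w))" by (rule dim[OF x])
        show "?cF x + ?cG x \<le> poly q ?N"
          unfolding q_def poly_add by (intro add_mono qF[OF w x] qG[OF w x])
        have "rat_bits (ip_obj (P w) x) \<le> ?cF x"
          by (simp add: tm_eval_cost_def length_rat_word)
        then show "rat_bits (ip_obj (P w) x) \<le> poly q ?N"
          using qF[OF w x] by (simp add: q_def)
        fix i assume i: "i < ip_ncon (P w)"
        let ?z = "ip_con (P w) x"
        have "rat_bits (?z $ i) \<le> length (rat_word (?z $ i))" by (simp add: length_rat_word)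
        also have "\<dots> \<le> length (vec_word rat_word ?z)"
          unfolding length_vec_word using dim[OF x] i by (intro member_le_sum) auto
        also have "\<dots> \<le> ?cG x" by (simp add: tm_eval_cost_def)
        finally show "rat_bits (?z $ i) \<le> poly q ?N"
          using qG[OF w x] by (simp add: q_def)
      qed
      note main = algorithm1_bounded_run[OF assms(1) L_def run]
      have "(ip_dim (P w) + 1) ^ L \<le> (1 + ?N) ^ L" by (intro power_mono) auto
      moreover have "M \<le> (1 + ?N) * (poly q ?N + 1)\<^sup>2"
        unfolding M_def by (intro mult_le_mono1) simp
      ultimately have "(ip_dim (P w) + 1) ^ L * (poly q ?N + M)
          \<le> (1 + ?N) ^ L * (poly q ?N + (1 + ?N) * (poly q ?N + 1)\<^sup>2)"
        by (intro mult_le_mono add_left_mono)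
      then have "run_factor K L * ((ip_dim (P w) + 1) ^ L * (poly q ?N + M)) \<le> poly p ?N"
        unfolding p_def by (simp add: add.commute)
      with main show "solves (P w) l result \<and> time \<le> poly p ?N" by linarith
    qed
  next
    case (2 \<delta>)
    let ?C = "run_factor K L * 2 ^ L * (3 * K + 3)"
    show ?case
    proof (intro exI[of _ "real (?C * (2 * L + 10)\<^sup>2)"] allI impI, clarify)
      fix n m A b c result time
      assume n: "1 \<le> n" and m: "1 \<le> m" and A: "A \<in> carrier_mat m n"
        and b: "b \<in> carrier_vec m" and c: "c \<in> carrier_vec n"
        and run: "algorithm1 E (ilp A b c) (ilp_obj_cost E c) (ilp_con_cost E A b) l = (result, time)"
      let ?s = "ilp_bits A b c"
      interpret bounded_run E K "ilp A b c" "ilp_obj_cost E c" "ilp_con_cost E A b" L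
        "3 * K * (((2 * L + 10) * ?s)\<^sup>2 * m * n ^ 1)" "2 * ((L + 2) * ?s) + 4"
        by (rule bounded_run_ilp[OF n m A b c])
      have dim: "ip_dim (ilp A b c) = n" "ip_ncon (ilp A b c) = m" using A by (auto simp: ilp_def)
      have "1 \<le> ?s" using vec_bits_ge[OF c] ilp_bits_ge(1)[of c A b] n by linarith
      then have q: "2 * ((L + 2) * ?s) + 4 + 1 \<le> (2 * L + 10) * ?s"
        by (simp add: algebra_simps)
      have "time \<le> ?C * (((2 * L + 10) * ?s)\<^sup>2 * m * n ^ (L + 1))"
        using algorithm1_monomial_time[OF assms(1) L_def run, of 1 "3 * K" "(2 * L + 10) * ?s"] n m q
        by (simp only: dim)
      then have "time \<le> ?C * ((2 * L + 10) * ?s)\<^sup>2 * m * n ^ (L + 1)" by (simp only: mult.assoc)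
      from real_time_le_powr[OF assms(1) L_def _ n this, of \<delta>] 2
      show "solves (ilp A b c) l result \<and> real time \<le> real (?C * (2 * L + 10)\<^sup>2) *
          ((real ?s)\<^sup>2 * real m * real n powr (((2 + \<delta>) * real_of_int \<lfloor>l\<rfloor>)\<^sup>2 / 2 + 1))"
        using algorithm1_bounded_run(1)[OF assms(1) L_def run] by simp
    qed
  next
    case (3 \<delta>)
    show ?case
    proof (intro exI[of _ "real (?D * (4 * L + 25)\<^sup>2)"] allI impI, clarify)
      fix n m Q c A b d result time
      assume n: "1 \<le> n" and m: "1 \<le> m" and Q: "Q \<in> carrier_mat n n" and c: "c \<in> carrier_vec n"
        and Ab: "\<forall>i<m. A i \<in> carrier_mat n n \<and> b i \<in> carrier_vec n"
        and run: "algorithm1 E (iqp n m (transpose_mat Q) c A b d)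
          (iqp_obj_cost E (transpose_mat Q) c) (iqp_con_cost E m A b d) l = (result, time)"
      have "transpose_mat Q \<in> carrier_mat n n" using Q by simp
      from iqp_bound[OF n m this c Ab run conjunct1[OF 3]]
      show "solves (iqp n m (transpose_mat Q) c A b d) l result \<and>
          real time \<le> real (?D * (4 * L + 25)\<^sup>2) * ((real (iqp_bits m Q c A b d))\<^sup>2 * real m *
            real n powr (((2 + \<delta>) * real_of_int \<lfloor>l\<rfloor>)\<^sup>2 / 2 + 2))"
        by (simp only: iqp_bits_def mat_bits_transpose)
    qed
  next
    case (4 \<delta>)
    show ?case
    proof (intro exI[of _ "real (?D * (4 * L + 25)\<^sup>2)"] allI impI, clarify)
      fix n m Q c A b d result time
      assume n: "1 \<le> n" and m: "1 \<le> m" and Q: "Q \<in> carrier_mat n n" and c: "c \<in> carrier_vec n"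
        and Ab: "\<forall>i<m. A i \<in> carrier_mat n n \<and> b i \<in> carrier_vec n"
        and run: "algorithm1 E (iqp n m Q c A b d)
          (iqp_obj_cost E Q c) (iqp_con_cost E m A b d) l = (result, time)"
      from iqp_bound[OF n m Q c Ab run conjunct1[OF 4]]
      show "solves (iqp n m Q c A b d) l result \<and>
          real time \<le> real (?D * (4 * L + 25)\<^sup>2) * ((real (iqp_bits m Q c A b d))\<^sup>2 * real m *
            real n powr (((2 + \<delta>) * real_of_int \<lfloor>l\<rfloor>)\<^sup>2 / 2 + 2))" .
    qed
  qed
qed

end
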